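(* Let $(M^3,\varphi,\xi,\eta,g)$ be a three-dimensional contact metric manifold, let $\lambda$ be a smooth function on $M$ and $\rho\in\mathbb{R}$ a constant, and let $r$ denote the scalar curvature of $g$. On the open set $U=\{p\in M: h_p\neq 0\}$ choose a local orthonormal $\varphi$-basis $\{e,\varphi e,\xi\}$ such that $$he=\ell e,\qquad h\varphi e=-\ell\varphi e,$$ where $\ell>0$ is a smooth function on $U$. Let $a,b,c$ be the functions $$a=g(\nabla_\xi e,\varphi e),\qquad b=g(\nabla_e e,\varphi e),\qquad c=g(\nabla_{\varphi e}\varphi e,e),$$ and put $A=\operatorname{Ric}(e,\xi)$, $B=\operatorname{Ric}(\varphi e,\xi)$, $Z=\xi(\ell)$. Let $$V=f_1e+f_2\varphi e+f_3\xi$$ be a (smooth) vector field on $U$, and put $\Lambda=\lambda+\rho r$. Then the almost Ricci--Bourguignon soliton equation $$\operatorname{Ric}+\tfrac12\mathcal{L}_Vg=\Lambda g$$ is equivalent to the following system: \begin{align*} \tfrac r2-1+\ell^2-2a\ell+e(f_1)-bf_2&=\Lambda,\\ \tfrac r2-1+\ell^2+2a\ell+(\varphi e)(f_2)-cf_1&=\Lambda,\\ 2(1-\ell^2)+\xi(f_3)&=\Lambda,\\ Z+\tfrac12\left\{e(f_2)+(\varphi e)(f_1)+bf_1+cf_2-2\ell f_3\right\}&=0,\\ A+\tfrac12\left\{e(f_3)+\xi(f_1)+(1+\ell-a)f_2\right\}&=0,\\ B+\tfrac12\left\{(\varphi e)(f_3)+\xi(f_2)+(a+\ell-1)f_1\right\}&=0.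 \end{align*}
   Context: A contact metric manifold $(M^{2n+1},\varphi,\xi,\eta,g)$ is a Riemannian manifold $(M,g)$ with a global 1-form $\eta$ satisfying $\eta\wedge(d\eta)^n\neq0$ everywhere, a unit vector field $\xi$ (the Reeb vector field) with $\eta(\xi)=1$ and $d\eta(\xi,\cdot)=0$, and a $(1,1)$-tensor field $\varphi$ with $d\eta(X,Y)=g(X,\varphi Y)$, $\eta(X)=g(X,\xi)$, $\varphi^2X=-X+\eta(X)\xi$. The normalization is $d\eta(X,Y)=\frac12\{X\eta(Y)-Y\eta(X)-\eta([X,Y])\}$, so that $\nabla_X\xi=-\varphi X-\varphi hX$, where $\nabla$ is the Levi-Civita connection and $h=\frac12\mathcal{L}_\xi\varphi$ is a self-adjoint, trace-free operator with $h\varphi=-\varphi h$ and $h\xi=0$. On $U=\{h\neq0\}$ (dimension 3) local orthonormal frames $\{e,\varphi e,\xi\}$ as in the claim exist, and in such a frame the connection is $\nabla_\xi e=a\varphi e$, $\nabla_\xi\varphi e=-ae$, $\nabla_\xi\xi=0$, $\nabla_e\xi=-(1+\ell)\varphi e$, $\nabla_ee=b\varphi e$, $\nabla_e\varphi e=-be+(1+\ell)\xi$, $\nabla_{\varphi e}\xi=(1-\ell)e$, $\nabla_{\varphi e}\varphi e=ce$, $\nabla_{\varphi e}e=-c\varphi e+(\ell-1)\xi$. $\operatorname{Ric}$ is the Ricci tensor and $\mathcal{L}_Vg$ is the Lie derivative of $g$ along $V$. The equivalence is understood on the domain of the local frame. *)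

theory Defs
  imports "HOL-Analysis.Analysis" "HOL-Library.Function_Algebras"
begin

text \<open>
  A manifold is the whole of a Hausdorff, second countable type \<open>'m\<close> together with a smooth atlas.
  A tangent vector at \<open>p\<close> is a derivation at \<open>p\<close> on germs of smooth functions; germs are
  represented by total functions \<open>'m \<Rightarrow> real\<close> that are smooth on some open neighbourhood of \<open>p\<close>.
  Vector fields, connections and tensor fields are total functions that are only constrained on the
  open set on which they are considered.
\<close>

instantiation "fun" :: (type, real_vector) real_vector
begin

definition scaleR_fun :: "real \<Rightarrow> ('a \<Rightarrow> 'b) \<Rightarrow> 'a \<Rightarrow> 'b"
  where "scaleR_fun c f = (\<lambda>x. c *\<^sub>R f x)"

instance
  by standard (simp_all add: scaleR_fun_def fun_eq_iff scaleR_add_right scaleR_add_left)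

end

text \<open>Only meant for open \<open>S\<close> in a finite-dimensional space.\<close>

primrec ck_on :: "nat \<Rightarrow> 'a::real_normed_vector set \<Rightarrow> ('a \<Rightarrow> 'b::real_normed_vector) \<Rightarrow> bool" where
  "ck_on 0 S f \<longleftrightarrow> continuous_on S f"
| "ck_on (Suc k) S f \<longleftrightarrow>
     f differentiable_on S \<and> (\<forall>v. ck_on k S (\<lambda>x. frechet_derivative f (at x) v))"

definition smooth_on :: "'a::real_normed_vector set \<Rightarrow> ('a \<Rightarrow> 'b::real_normed_vector) \<Rightarrow> bool"
  where "smooth_on S f \<longleftrightarrow> (\<forall>k. ck_on k S f)"

type_synonym ('m, 'e) atlas = "('m set \<times> ('m \<Rightarrow> 'e)) set"

definition smooth_atlas ::
    "('m::topological_space, 'e::euclidean_space) atlas \<Rightarrow> bool" where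
  "smooth_atlas \<A> \<longleftrightarrow>
     (\<Union>(D, x)\<in>\<A>. D) = UNIV \<and>
     (\<forall>(D, x)\<in>\<A>. open D \<and> open (x ` D) \<and> homeomorphism D (x ` D) x (inv_into D x)) \<and>
     (\<forall>(D, x)\<in>\<A>. \<forall>(D', y)\<in>\<A>. smooth_on (x ` (D \<inter> D')) (y \<circ> inv_into D x))"

definition smooth_fun ::
    "('m::topological_space, 'e::euclidean_space) atlas \<Rightarrow> 'm set \<Rightarrow> ('m \<Rightarrow> real) \<Rightarrow> bool" where
  "smooth_fun \<A> W f \<longleftrightarrow> (\<forall>(D, x)\<in>\<A>. smooth_on (x ` (D \<inter> W)) (f \<circ> inv_into D x))"

definition smooth_near ::
    "('m::topological_space, 'e::euclidean_space) atlas \<Rightarrow> 'm \<Rightarrow> ('m \<Rightarrow> real) \<Rightarrow> bool" where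
  "smooth_near \<A> p f \<longleftrightarrow> (\<exists>W. open W \<and> p \<in> W \<and> smooth_fun \<A> W f)"

type_synonym 'm tangent = "('m \<Rightarrow> real) \<Rightarrow> real"
type_synonym 'm field = "'m \<Rightarrow> 'm tangent"

text \<open>
  The value \<open>0\<close> on functions that are not smooth near \<open>p\<close> makes tangent vectors equal as soon
  as they agree on germs of smooth functions. No separate locality condition is needed: if \<open>f\<close> and
  \<open>f'\<close> agree on an open \<open>W\<close> containing \<open>p\<close> and \<open>h\<close> is the indicator of \<open>W\<close>, then \<open>h * h = h\<close> and
  \<open>h * f = h * f'\<close>, so the Leibniz rule gives \<open>v h = 0\<close> and then \<open>v f = v f'\<close>.
\<close>

definition tangent_space ::
    "('m::topological_space, 'e::euclidean_space) atlas \<Rightarrow> 'm \<Rightarrow> 'm tangent set" where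
  "tangent_space \<A> p = {v.
     (\<forall>f g. smooth_near \<A> p f \<longrightarrow> smooth_near \<A> p g \<longrightarrow>
        v (f + g) = v f + v g \<and> v (f * g) = f p * v g + g p * v f) \<and>
     (\<forall>c f. smooth_near \<A> p f \<longrightarrow> v (c *\<^sub>R f) = c * v f) \<and>
     (\<forall>f. \<not> smooth_near \<A> p f \<longrightarrow> v f = 0)}"

definition vector_field ::
    "('m::topological_space, 'e::euclidean_space) atlas \<Rightarrow> 'm set \<Rightarrow> 'm field \<Rightarrow> bool" where
  "vector_field \<A> W X \<longleftrightarrow>
     (\<forall>p\<in>W. X p \<in> tangent_space \<A> p) \<and>
     (\<forall>N f. open N \<longrightarrow> N \<subseteq> W \<longrightarrow> smooth_fun \<A> N f \<longrightarrow> smooth_fun \<A> N (\<lambda>q. X q f))"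

definition bracket ::
    "('m::topological_space, 'e::euclidean_space) atlas \<Rightarrow> 'm field \<Rightarrow> 'm field \<Rightarrow> 'm field" where
  "bracket \<A> X Y p f =
     (if smooth_near \<A> p f then X p (\<lambda>q. Y q f) - Y p (\<lambda>q. X q f) else 0)"

text \<open>Some local vector field with prescribed value at \<open>p\<close>, used to evaluate tensors at a point.\<close>

definition extend ::
    "('m::topological_space, 'e::euclidean_space) atlas \<Rightarrow> 'm \<Rightarrow> 'm tangent \<Rightarrow> 'm field" where
  "extend \<A> p u = (SOME X. (\<exists>W. open W \<and> p \<in> W \<and> vector_field \<A> W X) \<and> X p = u)"

type_synonym 'm metric = "'m \<Rightarrow> 'm tangent \<Rightarrow> 'm tangent \<Rightarrow> real"
type_synonym 'm connection = "'m \<Rightarrow> 'm tangent \<Rightarrow> 'm field \<Rightarrow> 'm tangent"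

definition riemannian_metric ::
    "('m::topological_space, 'e::euclidean_space) atlas \<Rightarrow> 'm metric \<Rightarrow> bool" where
  "riemannian_metric \<A> g \<longleftrightarrow>
     (\<forall>p. \<forall>u\<in>tangent_space \<A> p. \<forall>v\<in>tangent_space \<A> p.
        g p u v = g p v u \<and> (u \<noteq> 0 \<longrightarrow> g p u u > 0) \<and>
        (\<forall>w\<in>tangent_space \<A> p. g p (u + v) w = g p u w + g p v w) \<and>
        (\<forall>c. g p (c *\<^sub>R u) v = c * g p u v)) \<and>
     (\<forall>W X Y. open W \<longrightarrow> vector_field \<A> W X \<longrightarrow> vector_field \<A> W Y \<longrightarrow>
        smooth_fun \<A> W (\<lambda>q. g q (X q) (Y q)))"

text \<open>
  \<open>nab p u Y\<close> is the covariant derivative at \<open>p\<close> of the local field \<open>Y\<close> in the direction \<open>u\<close>.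
  As for tangent vectors, locality in \<open>Y\<close> follows from the Leibniz rule.
\<close>

definition affine_connection ::
    "('m::topological_space, 'e::euclidean_space) atlas \<Rightarrow> 'm connection \<Rightarrow> bool" where
  "affine_connection \<A> nab \<longleftrightarrow>
     (\<forall>W Y p. open W \<longrightarrow> p \<in> W \<longrightarrow> vector_field \<A> W Y \<longrightarrow>
        (\<forall>u\<in>tangent_space \<A> p.
           nab p u Y \<in> tangent_space \<A> p \<and>
           (\<forall>v\<in>tangent_space \<A> p. nab p (u + v) Y = nab p u Y + nab p v Y) \<and>
           (\<forall>c. nab p (c *\<^sub>R u) Y = c *\<^sub>R nab p u Y) \<and>
           (\<forall>Z. vector_field \<A> W Z \<longrightarrow> nab p u (Y + Z) = nab p u Y + nab p u Z) \<and>
           (\<forall>f. smooth_fun \<A> W f \<longrightarrow>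
              nab p u (\<lambda>q. f q *\<^sub>R Y q) = u f *\<^sub>R Y p + f p *\<^sub>R nab p u Y))) \<and>
     (\<forall>W X Y. open W \<longrightarrow> vector_field \<A> W X \<longrightarrow> vector_field \<A> W Y \<longrightarrow>
        vector_field \<A> W (\<lambda>p. nab p (X p) Y))"

definition levi_civita ::
    "('m::topological_space, 'e::euclidean_space) atlas \<Rightarrow> 'm metric \<Rightarrow> 'm connection \<Rightarrow> bool" where
  "levi_civita \<A> g nab \<longleftrightarrow>
     affine_connection \<A> nab \<and>
     (\<forall>W X Y. open W \<longrightarrow> vector_field \<A> W X \<longrightarrow> vector_field \<A> W Y \<longrightarrow>
        (\<forall>p\<in>W. nab p (X p) Y - nab p (Y p) X = bracket \<A> X Y p) \<and>
        (\<forall>p\<in>W. \<forall>u\<in>tangent_space \<A> p.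
           u (\<lambda>q. g q (X q) (Y q)) = g p (nab p u X) (Y p) + g p (X p) (nab p u Y)))"

definition curvature ::
    "('m::topological_space, 'e::euclidean_space) atlas \<Rightarrow> 'm connection
       \<Rightarrow> 'm field \<Rightarrow> 'm field \<Rightarrow> 'm field \<Rightarrow> 'm field" where
  "curvature \<A> nab X Y Z p =
     nab p (X p) (\<lambda>q. nab q (Y q) Z) - nab p (Y p) (\<lambda>q. nab q (X q) Z)
       - nab p (bracket \<A> X Y p) Z"

definition orthonormal_basis ::
    "('m::topological_space, 'e::euclidean_space) atlas \<Rightarrow> 'm metric \<Rightarrow> 'm \<Rightarrow> 'm tangent list \<Rightarrow> bool"
  where
  "orthonormal_basis \<A> g p E \<longleftrightarrow>
     span (set E) = tangent_space \<A> p \<and>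
     (\<forall>i<length E. \<forall>j<length E. g p (E ! i) (E ! j) = (if i = j then 1 else 0))"

definition metric_trace ::
    "('m::topological_space, 'e::euclidean_space) atlas \<Rightarrow> 'm metric \<Rightarrow> 'm
       \<Rightarrow> ('m tangent \<Rightarrow> 'm tangent \<Rightarrow> real) \<Rightarrow> real" where
  "metric_trace \<A> g p B = (\<Sum>u\<leftarrow>(SOME E. orthonormal_basis \<A> g p E). B u u)"

text \<open>\<open>Ric(v,w)\<close> is the trace of \<open>u \<mapsto> R(u,v)w\<close>.\<close>

definition Ric ::
    "('m::topological_space, 'e::euclidean_space) atlas \<Rightarrow> 'm metric \<Rightarrow> 'm connection \<Rightarrow> 'm
       \<Rightarrow> 'm tangent \<Rightarrow> 'm tangent \<Rightarrow> real" where
  "Ric \<A> g nab p v w = metric_trace \<A> g p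
     (\<lambda>u u'. g p (curvature \<A> nab (extend \<A> p u) (extend \<A> p v) (extend \<A> p w) p) u')"

definition scalar_curvature ::
    "('m::topological_space, 'e::euclidean_space) atlas \<Rightarrow> 'm metric \<Rightarrow> 'm connection \<Rightarrow> 'm \<Rightarrow> real"
  where
  "scalar_curvature \<A> g nab p = metric_trace \<A> g p (Ric \<A> g nab p)"

definition lie_metric ::
    "('m::topological_space, 'e::euclidean_space) atlas \<Rightarrow> 'm field \<Rightarrow> 'm metric \<Rightarrow> 'm metric" where
  "lie_metric \<A> V g p u v = (let X = extend \<A> p u; Y = extend \<A> p v in
     V p (\<lambda>q. g q (X q) (Y q)) - g p (bracket \<A> V X p) (Y p) - g p (X p) (bracket \<A> V Y p))"

type_synonym 'm one_form = "'m \<Rightarrow> 'm tangent \<Rightarrow> real"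
type_synonym 'm endo = "'m \<Rightarrow> 'm tangent \<Rightarrow> 'm tangent"

definition smooth_one_form ::
    "('m::topological_space, 'e::euclidean_space) atlas \<Rightarrow> 'm one_form \<Rightarrow> bool" where
  "smooth_one_form \<A> \<eta> \<longleftrightarrow>
     (\<forall>p. \<forall>u\<in>tangent_space \<A> p.
        (\<forall>v\<in>tangent_space \<A> p. \<eta> p (u + v) = \<eta> p u + \<eta> p v) \<and>
        (\<forall>c. \<eta> p (c *\<^sub>R u) = c * \<eta> p u)) \<and>
     (\<forall>W X. open W \<longrightarrow> vector_field \<A> W X \<longrightarrow> smooth_fun \<A> W (\<lambda>q. \<eta> q (X q)))"

definition smooth_endo ::
    "('m::topological_space, 'e::euclidean_space) atlas \<Rightarrow> 'm endo \<Rightarrow> bool" where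
  "smooth_endo \<A> \<phi> \<longleftrightarrow>
     (\<forall>p. \<forall>u\<in>tangent_space \<A> p. \<phi> p u \<in> tangent_space \<A> p \<and>
        (\<forall>v\<in>tangent_space \<A> p. \<phi> p (u + v) = \<phi> p u + \<phi> p v) \<and>
        (\<forall>c. \<phi> p (c *\<^sub>R u) = c *\<^sub>R \<phi> p u)) \<and>
     (\<forall>W X. open W \<longrightarrow> vector_field \<A> W X \<longrightarrow> vector_field \<A> W (\<lambda>q. \<phi> q (X q)))"

definition d_one_form ::
    "('m::topological_space, 'e::euclidean_space) atlas \<Rightarrow> 'm one_form
       \<Rightarrow> 'm field \<Rightarrow> 'm field \<Rightarrow> 'm \<Rightarrow> real" where
  "d_one_form \<A> \<eta> X Y p =
     (X p (\<lambda>q. \<eta> q (Y q)) - Y p (\<lambda>q. \<eta> q (X q)) - \<eta> p (bracket \<A> X Y p)) / 2"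

text \<open>\<open>\<eta> \<and> d\<eta>\<close>; the factor \<open>1/3\<close> matches the factor \<open>1/2\<close> in \<open>d\<eta>\<close>.\<close>

definition wedge_d ::
    "('m::topological_space, 'e::euclidean_space) atlas \<Rightarrow> 'm one_form
       \<Rightarrow> 'm field \<Rightarrow> 'm field \<Rightarrow> 'm field \<Rightarrow> 'm \<Rightarrow> real" where
  "wedge_d \<A> \<eta> X Y Z p =
     (\<eta> p (X p) * d_one_form \<A> \<eta> Y Z p + \<eta> p (Y p) * d_one_form \<A> \<eta> Z X p
       + \<eta> p (Z p) * d_one_form \<A> \<eta> X Y p) / 3"

definition contact_metric_3_manifold ::
    "('m::{t2_space, second_countable_topology}, real^3) atlas \<Rightarrow> 'm endo \<Rightarrow> 'm field
       \<Rightarrow> 'm one_form \<Rightarrow> 'm metric \<Rightarrow> bool" where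
  "contact_metric_3_manifold \<A> \<phi> \<xi> \<eta> g \<longleftrightarrow>
     smooth_atlas \<A> \<and> riemannian_metric \<A> g \<and> smooth_one_form \<A> \<eta> \<and> smooth_endo \<A> \<phi> \<and>
     vector_field \<A> UNIV \<xi> \<and>
     (\<forall>p. \<exists>W X Y Z. open W \<and> p \<in> W \<and> vector_field \<A> W X \<and> vector_field \<A> W Y \<and>
        vector_field \<A> W Z \<and> wedge_d \<A> \<eta> X Y Z p \<noteq> 0) \<and>
     (\<forall>p. g p (\<xi> p) (\<xi> p) = 1 \<and> \<eta> p (\<xi> p) = 1) \<and>
     (\<forall>W X. open W \<longrightarrow> vector_field \<A> W X \<longrightarrow> (\<forall>p\<in>W. d_one_form \<A> \<eta> \<xi> X p = 0)) \<and>
     (\<forall>W X Y. open W \<longrightarrow> vector_field \<A> W X \<longrightarrow> vector_field \<A> W Y \<longrightarrow>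
        (\<forall>p\<in>W. d_one_form \<A> \<eta> X Y p = g p (X p) (\<phi> p (Y p)))) \<and>
     (\<forall>p. \<forall>u\<in>tangent_space \<A> p.
        \<eta> p u = g p u (\<xi> p) \<and> \<phi> p (\<phi> p u) = - u + \<eta> p u *\<^sub>R \<xi> p)"

text \<open>\<open>h = (1/2) L\<^sub>\<xi> \<phi>\<close>, with \<open>(L\<^sub>\<xi> \<phi>) X = [\<xi>, \<phi> X] - \<phi> [\<xi>, X]\<close>.\<close>

definition contact_h ::
    "('m::topological_space, 'e::euclidean_space) atlas \<Rightarrow> 'm endo \<Rightarrow> 'm field \<Rightarrow> 'm endo" where
  "contact_h \<A> \<phi> \<xi> p u = (let X = extend \<A> p u in
     (1/2) *\<^sub>R (bracket \<A> \<xi> (\<lambda>q. \<phi> q (X q)) p - \<phi> p (bracket \<A> \<xi> X p)))"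

definition h_support ::
    "('m::topological_space, 'e::euclidean_space) atlas \<Rightarrow> 'm endo \<Rightarrow> 'm field \<Rightarrow> 'm set" where
  "h_support \<A> \<phi> \<xi> = {p. \<exists>u\<in>tangent_space \<A> p. contact_h \<A> \<phi> \<xi> p u \<noteq> 0}"

definition almost_rb_soliton_on ::
    "('m::topological_space, 'e::euclidean_space) atlas \<Rightarrow> 'm metric \<Rightarrow> 'm connection
       \<Rightarrow> 'm set \<Rightarrow> 'm field \<Rightarrow> ('m \<Rightarrow> real) \<Rightarrow> real \<Rightarrow> bool" where
  "almost_rb_soliton_on \<A> g nab W V lam rho \<longleftrightarrow>
     (\<forall>p\<in>W. \<forall>u\<in>tangent_space \<A> p. \<forall>v\<in>tangent_space \<A> p.
        Ric \<A> g nab p u v + (1/2) * lie_metric \<A> V g p u v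
          = (lam p + rho * scalar_curvature \<A> g nab p) * g p u v)"

end

(*
  On W the fields e, phi e, xi form an orthonormal frame, so every tensor is determined by its
  frame components. The connection coefficients come from d eta(X,Y) = g(X, phi Y), which gives the
  xi-components of brackets, from h e = ell e, and from div xi = 0; the last fact is the Jacobi
  identity for xi, e, phi e paired with xi. Apart from the sectional curvature of the plane
  spanned by e and phi e, which is expressed through r, the Ricci components other than A and B
  need only R(xi,e)xi and R(xi,phi e)xi. Since (L_V g)(u,v) = g(nabla_u V, v) + g(u, nabla_v V), the
  six equations are the frame components of the soliton equation.
*)

theory Submission
  imports Defs
begin

text \<open>The obstacle is that the definitions rest on arbitrary choices:
  \<open>contact_h\<close>, \<open>Ric\<close> and \<open>lie_metric\<close> evaluate tensors on the
  field picked by \<open>extend\<close>, and \<open>metric_trace\<close> picks an orthonormal basis.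
  Nothing can be computed until these expressions are known to depend only on values at the point,
  and much of the development serves that purpose. The classical argument uses bump functions. Here
  functions and fields are total but constrained only on an open set, so the indicator of an open
  neighbourhood is a smooth function on it, and multiplying by it turns equality on the
  neighbourhood into equality of total functions. The frame with constant coefficients supplies
  extensions of tangent vectors. The geometric computation stays short because the covariant
  derivative of \<xi> involves only \<open>ell\<close>, and differentiation of the frame along \<xi>
  involves only \<open>a\<close>, so no derivative of \<open>b\<close> or \<open>c\<close> is ever
  taken.\<close>

lemma scaleR_fun_apply: "(c *\<^sub>R f) x = c *\<^sub>R f x"
  by (simp add: scaleR_fun_def)

section \<open>Smooth functions\<close>

lemma ck_on_subset: "ck_on k S f \<Longrightarrow> T \<subseteq> S \<Longrightarrow> ck_on k T f"
  by (induction k arbitrary: f) (auto intro: continuous_on_subset differentiable_on_subset)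

text \<open>\<open>frechet_derivative\<close> is a choice among derivatives, so it suffices that
  both functions have the same derivatives at \<open>x\<close>. As \<open>at x\<close> is
  unrestricted, this takes equality on a whole neighbourhood.\<close>

lemma frechet_derivative_cong_open:
  assumes "open S" "x \<in> S" "\<And>y. y \<in> S \<Longrightarrow> f y = g y"
  shows "frechet_derivative f (at x) = frechet_derivative g (at x)"
proof -
  have "(f has_derivative F) (at x) \<longleftrightarrow> (g has_derivative F) (at x)" for F
    using has_derivative_transform_within_open[of f F x UNIV S g]
      has_derivative_transform_within_open[of g F x UNIV S f] assms by auto
  then show ?thesis
    by (simp add: frechet_derivative_def)
qed

lemma ck_on_cong:
  assumes "open S" "\<And>y. y \<in> S \<Longrightarrow> f y = g y" "ck_on k S f"
  shows "ck_on k S g"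
  using assms(2,3)
proof (induction k arbitrary: f g)
  case 0
  then show ?case
    using continuous_on_cong[of S S f g] by simp
next
  case (Suc k)
  have "g differentiable_on S"
    using Suc.prems differentiable_transform_within[of f _ S 1 g]
    by (auto simp: differentiable_on_def)
  moreover have "ck_on k S (\<lambda>x. frechet_derivative g (at x) v)" for v
  proof (rule Suc.IH)
    show "frechet_derivative f (at y) v = frechet_derivative g (at y) v" if "y \<in> S" for y
      using frechet_derivative_cong_open[OF assms(1) that Suc.prems(1)] by simp
    show "ck_on k S (\<lambda>x. frechet_derivative f (at x) v)"
      using Suc.prems(2) by simp
  qed
  ultimately show ?case by simp
qed

lemma ck_on_Suc_imp: "ck_on (Suc k) S f \<Longrightarrow> ck_on k S f"
  by (induction k arbitrary: f) (auto intro: differentiable_imp_continuous_on)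

lemma ck_on_const: "ck_on k S (\<lambda>x. c)"
  by (induction k arbitrary: c) auto

lemma has_derivative_frechet_on:
  assumes "open S" "ck_on (Suc k) S f" "x \<in> S"
  shows "(f has_derivative frechet_derivative f (at x)) (at x)"
  using assms by (metis at_within_open ck_on.simps(2) differentiable_on_def frechet_derivative_works)

text \<open>Lets an explicit derivative \<open>F\<close> stand in for the chosen one, so that
  differentiability classes of sums and products follow from the usual derivative rules.\<close>

lemma ck_on_SucI:
  assumes "open S" "\<And>x. x \<in> S \<Longrightarrow> (f has_derivative F x) (at x)"
    and "\<And>v. ck_on k S (\<lambda>x. F x v)"
  shows "ck_on (Suc k) S f"
proof -
  have "f differentiable_on S"
    using assms by (meson differentiable_at_imp_differentiable_on differentiable_def)
  moreover have "ck_on k S (\<lambda>x. frechet_derivative f (at x) v)" for v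
    using assms(3)[of v]
    by (rule ck_on_cong[OF assms(1), rotated]) (simp add: frechet_derivative_at[OF assms(2)])
  ultimately show ?thesis by simp
qed

lemma ck_on_add:
  assumes "open S" "ck_on k S f" "ck_on k S g"
  shows "ck_on k S (\<lambda>x. f x + g x)"
  using assms(2,3)
proof (induction k arbitrary: f g)
  case 0
  then show ?case by (auto intro: continuous_intros)
next
  case (Suc k)
  show ?case
  proof (rule ck_on_SucI[OF assms(1)])
    fix x assume "x \<in> S"
    then show "((\<lambda>x. f x + g x) has_derivative
        (\<lambda>v. frechet_derivative f (at x) v + frechet_derivative g (at x) v)) (at x)"
      using has_derivative_frechet_on[OF assms(1)] Suc.prems by (intro has_derivative_add) auto
  next
    fix v
    show "ck_on k S (\<lambda>x. frechet_derivative f (at x) v + frechet_derivative g (at x) v)"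
      using Suc by auto
  qed
qed

lemma ck_on_mult:
  fixes f g :: "'a::real_normed_vector \<Rightarrow> real"
  assumes "open S" "ck_on k S f" "ck_on k S g"
  shows "ck_on k S (\<lambda>x. f x * g x)"
  using assms(2,3)
proof (induction k arbitrary: f g)
  case 0
  then show ?case by (auto intro: continuous_intros)
next
  case (Suc k)
  show ?case
  proof (rule ck_on_SucI[OF assms(1)])
    fix x assume "x \<in> S"
    then show "((\<lambda>x. f x * g x) has_derivative
        (\<lambda>v. f x * frechet_derivative g (at x) v + frechet_derivative f (at x) v * g x)) (at x)"
      using has_derivative_frechet_on[OF assms(1)] Suc.prems by (intro has_derivative_mult) auto
  next
    fix v
    \<comment> \<open>The product rule multiplies an undifferentiated factor by a derivative, so
      \<open>f\<close> and \<open>g\<close> are lowered to class \<open>k\<close> before the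
      induction hypothesis applies.\<close>
    have "ck_on k S f" "ck_on k S g"
      using Suc.prems ck_on_Suc_imp by blast+
    then show "ck_on k S (\<lambda>x. f x * frechet_derivative g (at x) v + frechet_derivative f (at x) v * g x)"
      using Suc by (intro ck_on_add[OF assms(1)] Suc.IH) auto
  qed
qed

lemma smooth_fun_subset: "smooth_fun \<A> W f \<Longrightarrow> N \<subseteq> W \<Longrightarrow> smooth_fun \<A> N f"
  unfolding smooth_fun_def smooth_on_def by (fastforce intro: ck_on_subset)

lemma vector_field_subset: "vector_field \<A> W X \<Longrightarrow> N \<subseteq> W \<Longrightarrow> vector_field \<A> N X"
  unfolding vector_field_def by (meson subset_iff subset_trans)

lemma vector_fieldD: "vector_field \<A> W X \<Longrightarrow> p \<in> W \<Longrightarrow> X p \<in> tangent_space \<A> p"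
  unfolding vector_field_def by simp

lemma smooth_fun_vector_field:
  "vector_field \<A> W X \<Longrightarrow> open W \<Longrightarrow> smooth_fun \<A> W f \<Longrightarrow> smooth_fun \<A> W (\<lambda>q. X q f)"
  unfolding vector_field_def by simp

lemma smooth_nearI: "open W \<Longrightarrow> p \<in> W \<Longrightarrow> smooth_fun \<A> W f \<Longrightarrow> smooth_near \<A> p f"
  unfolding smooth_near_def by blast

lemma smooth_nearE:
  assumes "smooth_near \<A> p f" "open W" "p \<in> W"
  obtains N where "open N" "p \<in> N" "N \<subseteq> W" "smooth_fun \<A> N f"
proof -
  obtain M where "open M" "p \<in> M" "smooth_fun \<A> M f"
    using assms(1) unfolding smooth_near_def by blast
  then show ?thesis
    using that[of "M \<inter> W"] assms smooth_fun_subset by blast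
qed

locale smooth_manifold =
  fixes \<A> :: "('m::topological_space, 'e::euclidean_space) atlas"
  assumes atlas: "smooth_atlas \<A>"
begin

text \<open>A chart is an open map onto its image, and that image is open. This keeps every use of
  \<open>ck_on\<close> on an open set, where it has its intended meaning.\<close>

lemma open_chart_image:
  assumes "(D, x) \<in> \<A>" "open W"
  shows "open (x ` (D \<inter> W))"
proof -
  have *: "open D" "open (x ` D)" "homeomorphism D (x ` D) x (inv_into D x)"
    using atlas assms(1) unfolding smooth_atlas_def by auto
  have "openin (top_of_set (x ` D)) (x ` (D \<inter> W))"
    using homeomorphism_imp_open_map[OF *(3)] assms(2) by (metis openin_open)
  then show ?thesis
    using *(2) openin_open_trans by blast
qed

lemma chart_inverse: "(D, x) \<in> \<A> \<Longrightarrow> q \<in> D \<Longrightarrow> inv_into D x (x q) = q"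
  using atlas unfolding smooth_atlas_def homeomorphism_def by fastforce

lemma smooth_fun_cong:
  assumes "open W" "\<And>q. q \<in> W \<Longrightarrow> f q = f' q" "smooth_fun \<A> W f"
  shows "smooth_fun \<A> W f'"
  unfolding smooth_fun_def smooth_on_def
proof (clarify)
  fix D x k assume D: "(D, x) \<in> \<A>"
  show "ck_on k (x ` (D \<inter> W)) (f' \<circ> inv_into D x)"
  proof (rule ck_on_cong[OF open_chart_image[OF D assms(1)]])
    show "ck_on k (x ` (D \<inter> W)) (f \<circ> inv_into D x)"
      using assms(3) D unfolding smooth_fun_def smooth_on_def by fastforce
  qed (use assms(2) chart_inverse[OF D] in auto)
qed

lemma smooth_fun_const: "smooth_fun \<A> W (\<lambda>q. c)"
  unfolding smooth_fun_def smooth_on_def o_def by (simp add: ck_on_const)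

lemma smooth_fun_add:
  assumes "open W" "smooth_fun \<A> W f" "smooth_fun \<A> W f'"
  shows "smooth_fun \<A> W (\<lambda>q. f q + f' q)"
  using assms(2,3) ck_on_add[OF open_chart_image[OF _ assms(1)]]
  unfolding smooth_fun_def smooth_on_def o_def by fastforce

lemma smooth_fun_mult:
  assumes "open W" "smooth_fun \<A> W f" "smooth_fun \<A> W f'"
  shows "smooth_fun \<A> W (\<lambda>q. f q * f' q)"
  using assms(2,3) ck_on_mult[OF open_chart_image[OF _ assms(1)]]
  unfolding smooth_fun_def smooth_on_def o_def by fastforce

lemma smooth_fun_uminus:
  assumes "open W" "smooth_fun \<A> W f"
  shows "smooth_fun \<A> W (\<lambda>q. - f q)"
  using smooth_fun_mult[OF assms(1) smooth_fun_const[of W "-1"] assms(2)] by simp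

lemma smooth_fun_diff:
  assumes "open W" "smooth_fun \<A> W f" "smooth_fun \<A> W f'"
  shows "smooth_fun \<A> W (\<lambda>q. f q - f' q)"
  using smooth_fun_add[OF assms(1,2) smooth_fun_uminus[OF assms(1,3)]] by simp

section \<open>Tangent vectors and vector fields\<close>

context
  fixes p v assumes v: "v \<in> tangent_space \<A> p"
begin

lemma tangent_add:
  "smooth_near \<A> p f \<Longrightarrow> smooth_near \<A> p f' \<Longrightarrow> v (\<lambda>q. f q + f' q) = v f + v f'"
  using v unfolding tangent_space_def plus_fun_def by blast

lemma tangent_mult:
  "smooth_near \<A> p f \<Longrightarrow> smooth_near \<A> p f' \<Longrightarrow> v (\<lambda>q. f q * f' q) = f p * v f' + f' p * v f"
  using v unfolding tangent_space_def times_fun_def by blast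

lemma tangent_cmult: "smooth_near \<A> p f \<Longrightarrow> v (\<lambda>q. c * f q) = c * v f"
  using v unfolding tangent_space_def scaleR_fun_def real_scaleR_def by blast

lemma tangent_not_smooth: "\<not> smooth_near \<A> p f \<Longrightarrow> v f = 0"
  using v unfolding tangent_space_def by blast

lemma tangent_uminus: "smooth_near \<A> p f \<Longrightarrow> v (\<lambda>q. - f q) = - v f"
  using tangent_cmult[of f "-1"] by simp

end

lemma smooth_near_uminus: "smooth_near \<A> p f \<Longrightarrow> smooth_near \<A> p (\<lambda>q. - f q)"
  unfolding smooth_near_def using smooth_fun_uminus by blast

lemma smooth_near_const: "smooth_near \<A> p (\<lambda>q. c)"
  using smooth_nearI[OF open_UNIV _ smooth_fun_const] by blast

lemma smooth_near_cong:
  assumes "open W" "p \<in> W" "\<And>q. q \<in> W \<Longrightarrow> f q = f' q" "smooth_near \<A> p f"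
  shows "smooth_near \<A> p f'"
proof -
  obtain N where "open N" "p \<in> N" "N \<subseteq> W" "smooth_fun \<A> N f"
    using smooth_nearE[OF assms(4,1,2)] .
  then show ?thesis
    using smooth_fun_cong[of N f f'] assms(3) smooth_nearI by blast
qed

lemma tangent_diff:
  assumes "v \<in> tangent_space \<A> p" "smooth_near \<A> p f" "smooth_near \<A> p f'"
  shows "v (\<lambda>q. f q - f' q) = v f - v f'"
  using tangent_add[OF assms(1,2) smooth_near_uminus[OF assms(3)]] tangent_uminus[OF assms(1,3)]
  by simp

text \<open>On \<open>W\<close> the indicator is the constant 1, and germs at \<open>p\<close> see
  nothing else. It takes the role of a bump function.\<close>

lemma smooth_near_indicator:
  assumes "open W" "p \<in> W"
  shows "smooth_near \<A> p (indicat_real W)"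
  by (rule smooth_near_cong[OF assms _ smooth_near_const[of p 1]]) simp

lemma tangent_indicator:
  assumes "v \<in> tangent_space \<A> p" "open W" "p \<in> W"
  shows "v (indicat_real W) = 0"
proof -
  let ?h = "indicat_real W"
  have "(\<lambda>q. ?h q * ?h q) = ?h"
    by (auto simp: indicator_def)
  then have "v ?h = ?h p * v ?h + ?h p * v ?h"
    using tangent_mult[OF assms(1) smooth_near_indicator[OF assms(2,3)] smooth_near_indicator[OF assms(2,3)]]
    by simp
  then show ?thesis using assms(3) by simp
qed

lemma tangent_local:
  assumes v: "v \<in> tangent_space \<A> p" and W: "open W" "p \<in> W" "\<And>q. q \<in> W \<Longrightarrow> f q = f' q"
  shows "v f = v f'"
proof (cases "smooth_near \<A> p f")
  case True
  note ind = smooth_near_indicator[OF W(1,2)]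
  have f': "smooth_near \<A> p f'" using smooth_near_cong[OF W True] .
  have "(\<lambda>q. indicat_real W q * f q) = (\<lambda>q. indicat_real W q * f' q)"
    using W(3) by (auto simp: indicator_def)
  then show ?thesis
    using tangent_mult[OF v ind True] tangent_mult[OF v ind f'] tangent_indicator[OF v W(1,2)] W(2)
    by simp
next
  \<comment> \<open>Then \<open>f'\<close> is not smooth near \<open>p\<close> either, and tangent
    vectors take the default value 0 on both.\<close>
  case False
  moreover have "\<not> smooth_near \<A> p f'"
    using False smooth_near_cong[OF W(1,2), of f' f] W(3) by metis
  ultimately show ?thesis using tangent_not_smooth[OF v] by simp
qed

text \<open>The constant 1 is the indicator of the whole space, hence killed by the idempotent
  argument; homogeneity gives the other constants.\<close>

lemma tangent_const:
  assumes v: "v \<in> tangent_space \<A> p"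
  shows "v (\<lambda>q. c) = 0"
proof -
  have "indicat_real (UNIV :: 'm set) = (\<lambda>q. 1)" by auto
  then have "v (\<lambda>q. 1) = 0" using tangent_indicator[OF v open_UNIV UNIV_I] by metis
  then show ?thesis
    using tangent_cmult[OF v smooth_near_const[of p 1], of c] by simp
qed

lemma tangent_locally_const:
  assumes "v \<in> tangent_space \<A> p" "open W" "p \<in> W" "\<And>q. q \<in> W \<Longrightarrow> f q = c"
  shows "v f = 0"
  using tangent_local[OF assms(1-3), of f "\<lambda>q. c"] tangent_const[OF assms(1)] assms(4) by simp

lemma tangent_space_zero: "0 \<in> tangent_space \<A> p"
  unfolding tangent_space_def by simp

lemma tangent_space_add:
  "u \<in> tangent_space \<A> p \<Longrightarrow> v \<in> tangent_space \<A> p \<Longrightarrow> u + v \<in> tangent_space \<A> p"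
  unfolding tangent_space_def by (simp add: scaleR_fun_apply algebra_simps)

lemma tangent_space_scale: "u \<in> tangent_space \<A> p \<Longrightarrow> k *\<^sub>R u \<in> tangent_space \<A> p"
  unfolding tangent_space_def by (simp add: scaleR_fun_apply algebra_simps)

lemma subspace_tangent_space: "subspace (tangent_space \<A> p)"
  by (simp add: subspace_def tangent_space_zero tangent_space_add tangent_space_scale)

lemmas tangent_space_uminus = subspace_neg[OF subspace_tangent_space]
lemmas tangent_space_diff = subspace_diff[OF subspace_tangent_space]

lemma vector_field_cong:
  assumes "open W" "\<And>q. q \<in> W \<Longrightarrow> X q = Y q" "vector_field \<A> W X"
  shows "vector_field \<A> W Y"
proof -
  have "smooth_fun \<A> N (\<lambda>q. Y q f)" if "open N" "N \<subseteq> W" "smooth_fun \<A> N f" for N f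
    by (rule smooth_fun_cong[OF that(1), of "\<lambda>q. X q f"])
       (use that assms in \<open>auto simp: vector_field_def\<close>)
  then show ?thesis
    using assms unfolding vector_field_def by auto
qed

lemma vector_field_add:
  assumes "vector_field \<A> W X" "vector_field \<A> W Y"
  shows "vector_field \<A> W (\<lambda>q. X q + Y q)"
  using assms unfolding vector_field_def by (auto intro: tangent_space_add smooth_fun_add)

lemma vector_field_scale:
  assumes "smooth_fun \<A> W f" "vector_field \<A> W X"
  shows "vector_field \<A> W (\<lambda>q. f q *\<^sub>R X q)"
  using assms smooth_fun_subset
  unfolding vector_field_def by (auto intro!: tangent_space_scale smooth_fun_mult simp: scaleR_fun_apply)

lemma vector_field_zero: "vector_field \<A> W (\<lambda>q. 0)"
  unfolding vector_field_def by (auto intro: tangent_space_zero smooth_fun_const)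

lemma vector_field_uminus: "vector_field \<A> W X \<Longrightarrow> vector_field \<A> W (\<lambda>q. - X q)"
  using vector_field_scale[OF smooth_fun_const[of W "-1"]] by simp

section \<open>The Lie bracket\<close>

lemma smooth_near_vector_field:
  assumes "vector_field \<A> W X" "open W" "p \<in> W" "smooth_near \<A> p f"
  shows "smooth_near \<A> p (\<lambda>q. X q f)"
proof -
  obtain N where N: "open N" "p \<in> N" "N \<subseteq> W" "smooth_fun \<A> N f"
    using smooth_nearE[OF assms(4,2,3)] .
  then show ?thesis
    using smooth_fun_vector_field[OF vector_field_subset[OF assms(1)]] smooth_nearI by blast
qed

lemma bracket_apply:
  "smooth_near \<A> p f \<Longrightarrow> bracket \<A> X Y p f = X p (\<lambda>q. Y q f) - Y p (\<lambda>q. X q f)"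
  by (simp add: bracket_def)

lemma bracket_swap: "bracket \<A> X Y p = - bracket \<A> Y X p"
  by (auto simp: bracket_def fun_eq_iff)

text \<open>Each outer derivation sees the inner function only near \<open>p\<close>. Since
  \<open>tangent_local\<close> also covers functions that are not smooth, the argument is uniform in
  \<open>f\<close>.\<close>

lemma bracket_local:
  assumes W: "open W" "p \<in> W" and X: "vector_field \<A> W X" "vector_field \<A> W X'"
    and Y: "vector_field \<A> W Y" "vector_field \<A> W Y'"
    and eq: "\<And>q. q \<in> W \<Longrightarrow> X q = X' q" "\<And>q. q \<in> W \<Longrightarrow> Y q = Y' q"
  shows "bracket \<A> X Y p = bracket \<A> X' Y' p"
proof
  fix f
  have "X p (\<lambda>q. Y q f) = X p (\<lambda>q. Y' q f)"
    using tangent_local[OF vector_fieldD[OF X(1)] W] W eq by metis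
  moreover have "Y p (\<lambda>q. X q f) = Y p (\<lambda>q. X' q f)"
    using tangent_local[OF vector_fieldD[OF Y(1)] W] W eq by metis
  ultimately show "bracket \<A> X Y p f = bracket \<A> X' Y' p f"
    using eq W by (simp add: bracket_def)
qed

lemma bracket_add_right:
  assumes W: "open W" "p \<in> W" and X: "vector_field \<A> W X"
    and Y: "vector_field \<A> W Y" and Z: "vector_field \<A> W Z"
  shows "bracket \<A> X (\<lambda>q. Y q + Z q) p = bracket \<A> X Y p + bracket \<A> X Z p"
proof
  fix f
  show "bracket \<A> X (\<lambda>q. Y q + Z q) p f = (bracket \<A> X Y p + bracket \<A> X Z p) f"
    using tangent_add[OF vector_fieldD[OF X W(2)]] smooth_near_vector_field[OF Y W]
      smooth_near_vector_field[OF Z W]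
    by (simp add: bracket_def)
qed

lemma bracket_scale_right:
  assumes W: "open W" "p \<in> W" and X: "vector_field \<A> W X"
    and Y: "vector_field \<A> W Y" and h: "smooth_fun \<A> W h"
  shows "bracket \<A> X (\<lambda>q. h q *\<^sub>R Y q) p = X p h *\<^sub>R Y p + h p *\<^sub>R bracket \<A> X Y p"
proof
  fix f
  show "bracket \<A> X (\<lambda>q. h q *\<^sub>R Y q) p f = (X p h *\<^sub>R Y p + h p *\<^sub>R bracket \<A> X Y p) f"
  proof (cases "smooth_near \<A> p f")
    case True
    then show ?thesis
      using tangent_mult[OF vector_fieldD[OF X W(2)] smooth_nearI[OF W h] smooth_near_vector_field[OF Y W True]]
      by (simp add: bracket_def scaleR_fun_apply algebra_simps)
  next
    \<comment> \<open>Off the smooth germs the bracket is 0 by definition, and \<open>Y p\<close> is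
      0 because it is a tangent vector; both sides vanish.\<close>
    case False
    then show ?thesis
      using tangent_not_smooth[OF vector_fieldD[OF Y W(2)]] by (simp add: bracket_def scaleR_fun_apply)
  qed
qed

lemma bracket_nested_apply:
  assumes W: "open W" "p \<in> W"
    and X: "vector_field \<A> W X" and Y: "vector_field \<A> W Y" and Z: "vector_field \<A> W Z"
    and f: "smooth_near \<A> p f"
  shows "bracket \<A> X (bracket \<A> Y Z) p f =
    X p (\<lambda>q. Y q (\<lambda>q. Z q f)) - X p (\<lambda>q. Z q (\<lambda>q. Y q f))
      - (Y p (\<lambda>q. Z q (\<lambda>q. X q f)) - Z p (\<lambda>q. Y q (\<lambda>q. X q f)))"
proof -
  obtain N where N: "open N" "p \<in> N" "N \<subseteq> W" "smooth_fun \<A> N f"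
    using smooth_nearE[OF f W] .
  note sv = smooth_near_vector_field[OF _ W]
  \<comment> \<open>The inner bracket is a commutator at \<open>q\<close> only if \<open>f\<close>
    is smooth near \<open>q\<close>. This holds throughout \<open>N\<close>, so the replacement is
    made on \<open>N\<close> and transferred by locality.\<close>
  have "X p (\<lambda>q. bracket \<A> Y Z q f) = X p (\<lambda>q. Y q (\<lambda>q. Z q f) - Z q (\<lambda>q. Y q f))"
    by (rule tangent_local[OF vector_fieldD[OF X W(2)] N(1,2)])
       (simp add: bracket_apply smooth_nearI[OF N(1) _ N(4)])
  also have "\<dots> = X p (\<lambda>q. Y q (\<lambda>q. Z q f)) - X p (\<lambda>q. Z q (\<lambda>q. Y q f))"
    by (rule tangent_diff[OF vector_fieldD[OF X W(2)] sv[OF Y sv[OF Z f]] sv[OF Z sv[OF Y f]]])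
  finally show ?thesis
    using f sv[OF X f] by (simp add: bracket_apply)
qed

text \<open>On a smooth germ each nested bracket is a signed sum of four triple derivatives, and the
  twelve terms of the cyclic sum cancel in pairs.\<close>

lemma jacobi:
  assumes W: "open W" "p \<in> W"
    and X: "vector_field \<A> W X" and Y: "vector_field \<A> W Y" and Z: "vector_field \<A> W Z"
  shows "bracket \<A> X (bracket \<A> Y Z) p + bracket \<A> Y (bracket \<A> Z X) p
    + bracket \<A> Z (bracket \<A> X Y) p = 0"
proof
  fix f
  show "(bracket \<A> X (bracket \<A> Y Z) p + bracket \<A> Y (bracket \<A> Z X) p
    + bracket \<A> Z (bracket \<A> X Y) p) f = 0 f"
  proof (cases "smooth_near \<A> p f")
    case True
    then show ?thesis
      by (simp add: bracket_nested_apply[OF W] X Y Z)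
  next
    case False
    then show ?thesis by (simp add: bracket_def)
  qed
qed

end

section \<open>Linear algebra on tangent spaces\<close>

text \<open>Tangent spaces are subspaces of a type of functions, and tensors are unconstrained
  outside them; linearity is therefore relative to a set.\<close>

definition linear_within :: "'a::real_vector set \<Rightarrow> ('a \<Rightarrow> 'b::real_vector) \<Rightarrow> bool" where
  "linear_within S f \<longleftrightarrow>
     (\<forall>u\<in>S. \<forall>v\<in>S. f (u + v) = f u + f v) \<and> (\<forall>c. \<forall>u\<in>S. f (c *\<^sub>R u) = c *\<^sub>R f u)"

lemma linear_withinI:
  assumes "\<And>u v. u \<in> S \<Longrightarrow> v \<in> S \<Longrightarrow> f (u + v) = f u + f v"
    and "\<And>c u. u \<in> S \<Longrightarrow> f (c *\<^sub>R u) = c *\<^sub>R f u"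
  shows "linear_within S f"
  using assms unfolding linear_within_def by blast

lemma linear_within_zero: "subspace S \<Longrightarrow> linear_within S f \<Longrightarrow> f 0 = 0"
  unfolding linear_within_def by (metis scale_zero_left subspace_0)

lemma linear_within_sum:
  assumes "subspace S" "linear_within S f" "\<And>i. i \<in> I \<Longrightarrow> v i \<in> S"
  shows "f (\<Sum>i\<in>I. c i *\<^sub>R v i) = (\<Sum>i\<in>I. c i *\<^sub>R f (v i))"
  using assms(3)
proof (induction I rule: infinite_finite_induct)
  case (insert i I)
  have "(\<Sum>i\<in>I. c i *\<^sub>R v i) \<in> S"
    using insert.prems assms(1) by (intro subspace_sum) (auto intro: subspace_scale)
  moreover have "c i *\<^sub>R v i \<in> S" "v i \<in> S"
    using insert.prems assms(1) by (auto intro: subspace_scale)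
  ultimately show ?case
    using insert assms(2) by (simp add: linear_within_def)
qed (simp_all add: linear_within_zero[OF assms(1,2)])

lemma linear_within_add:
  "linear_within S f \<Longrightarrow> linear_within S h \<Longrightarrow> linear_within S (\<lambda>u. f u + h u)"
  unfolding linear_within_def by (simp add: algebra_simps)

lemma linear_within_scale: "linear_within S f \<Longrightarrow> linear_within S (\<lambda>u. k *\<^sub>R f u)"
  unfolding linear_within_def by (simp add: algebra_simps)

lemma linear_within_sum_fun:
  "(\<And>i. i \<in> I \<Longrightarrow> linear_within S (f i)) \<Longrightarrow> linear_within S (\<lambda>u. \<Sum>i\<in>I. f i u)"
  unfolding linear_within_def by (simp add: sum.distrib scaleR_sum_right)

locale metric_manifold = smooth_manifold \<A>
  for \<A> :: "('m::topological_space, 'e::euclidean_space) atlas" +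
  fixes g :: "'m metric"
  assumes metric: "riemannian_metric \<A> g"
begin

lemma g_sym: "u \<in> tangent_space \<A> p \<Longrightarrow> v \<in> tangent_space \<A> p \<Longrightarrow> g p u v = g p v u"
  using metric unfolding riemannian_metric_def by blast

lemma g_add_left:
  "u \<in> tangent_space \<A> p \<Longrightarrow> v \<in> tangent_space \<A> p \<Longrightarrow> w \<in> tangent_space \<A> p \<Longrightarrow>
    g p (u + v) w = g p u w + g p v w"
  using metric unfolding riemannian_metric_def by blast

lemma g_scale_left:
  "u \<in> tangent_space \<A> p \<Longrightarrow> v \<in> tangent_space \<A> p \<Longrightarrow> g p (k *\<^sub>R u) v = k * g p u v"
  using metric unfolding riemannian_metric_def by blast

lemma g_add_right:
  "u \<in> tangent_space \<A> p \<Longrightarrow> v \<in> tangent_space \<A> p \<Longrightarrow> w \<in> tangent_space \<A> p \<Longrightarrow>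
    g p w (u + v) = g p w u + g p w v"
  by (metis g_sym g_add_left tangent_space_add)

lemma g_scale_right:
  "u \<in> tangent_space \<A> p \<Longrightarrow> v \<in> tangent_space \<A> p \<Longrightarrow> g p v (k *\<^sub>R u) = k * g p v u"
  by (metis g_sym g_scale_left tangent_space_scale)

lemma g_uminus_left:
  "u \<in> tangent_space \<A> p \<Longrightarrow> v \<in> tangent_space \<A> p \<Longrightarrow> g p (- u) v = - g p u v"
  using g_scale_left[of u p v "-1"] by simp

lemma g_uminus_right:
  "u \<in> tangent_space \<A> p \<Longrightarrow> v \<in> tangent_space \<A> p \<Longrightarrow> g p u (- v) = - g p u v"
  using g_scale_right[of v p u "-1"] by simp

lemma g_diff_left:
  "u \<in> tangent_space \<A> p \<Longrightarrow> v \<in> tangent_space \<A> p \<Longrightarrow> w \<in> tangent_space \<A> p \<Longrightarrow>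
    g p (u - v) w = g p u w - g p v w"
  using g_add_left[of u p "- v" w] by (simp add: g_uminus_left tangent_space_uminus)

lemma g_diff_right:
  "u \<in> tangent_space \<A> p \<Longrightarrow> v \<in> tangent_space \<A> p \<Longrightarrow> w \<in> tangent_space \<A> p \<Longrightarrow>
    g p w (u - v) = g p w u - g p w v"
  by (metis g_sym g_diff_left tangent_space_diff)

lemma g_zero: "u \<in> tangent_space \<A> p \<Longrightarrow> g p u 0 = 0" "u \<in> tangent_space \<A> p \<Longrightarrow> g p 0 u = 0"
  using g_scale_left[of u p u 0] g_scale_right[of u p u 0] by simp_all

lemma linear_within_g_left:
  "w \<in> tangent_space \<A> p \<Longrightarrow> linear_within (tangent_space \<A> p) (\<lambda>u. g p u w)"
  by (auto intro: linear_withinI simp: g_add_left g_scale_left)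

lemma linear_within_g_right:
  "w \<in> tangent_space \<A> p \<Longrightarrow> linear_within (tangent_space \<A> p) (g p w)"
  by (auto intro: linear_withinI simp: g_add_right g_scale_right)

lemma smooth_fun_g:
  "open W \<Longrightarrow> vector_field \<A> W X \<Longrightarrow> vector_field \<A> W Y \<Longrightarrow> smooth_fun \<A> W (\<lambda>q. g q (X q) (Y q))"
  using metric unfolding riemannian_metric_def by simp

section \<open>Orthonormal bases and traces of bilinear forms\<close>

lemma orthonormal_basisD:
  assumes "orthonormal_basis \<A> g p F"
  shows "i < length F \<Longrightarrow> F ! i \<in> tangent_space \<A> p"
    and "i < length F \<Longrightarrow> j < length F \<Longrightarrow> g p (F ! i) (F ! j) = (if i = j then 1 else 0)"
  using assms span_superset[of "set F"] nth_mem[of i F] unfolding orthonormal_basis_def by auto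

text \<open>Both sides are linear in \<open>u\<close> and agree on the members of \<open>F\<close>.
  Membership in the tangent space is carried through the span induction because \<open>g\<close> is
  known to be linear only there.\<close>

lemma orthonormal_expand:
  assumes F: "orthonormal_basis \<A> g p F" and u: "u \<in> tangent_space \<A> p"
  shows "u = (\<Sum>i<length F. g p u (F ! i) *\<^sub>R F ! i)"
proof -
  note FD = orthonormal_basisD[OF F]
  have "u \<in> span (set F)"
    using F u unfolding orthonormal_basis_def by simp
  then have "u \<in> tangent_space \<A> p \<and> u = (\<Sum>i<length F. g p u (F ! i) *\<^sub>R F ! i)"
  proof (induction rule: span_induct)
    case base
    show ?case
      unfolding subspace_def
      by (auto simp: tangent_space_zero tangent_space_add tangent_space_scale g_zero g_add_left
          g_scale_left FD scaleR_add_left sum.distrib simp flip: scaleR_scaleR scaleR_sum_right)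
  next
    case (step x)
    then obtain j where j: "j < length F" "x = F ! j"
      by (metis in_set_conv_nth)
    have "(\<Sum>i<length F. g p x (F ! i) *\<^sub>R F ! i) = (\<Sum>i<length F. if j = i then F ! i else 0)"
      using j FD(2) by (intro sum.cong) auto
    also have "\<dots> = x"
      using j by simp
    finally show ?case
      using j FD(1) by metis
  qed
  then show ?thesis by blast
qed

text \<open>Expanding each vector of \<open>E\<close> in \<open>F\<close> produces the coefficients
  \<open>g p (F ! i) (E ! j) * g p (E ! j) (F ! k)\<close>. Summed over \<open>j\<close> they give
  \<open>g p (F ! i) (F ! k)\<close>, by expanding \<open>F ! i\<close> in \<open>E\<close>;
  orthonormality of \<open>F\<close> then leaves the diagonal.\<close>

lemma orthonormal_trace_eq:
  assumes E: "orthonormal_basis \<A> g p E" and F: "orthonormal_basis \<A> g p F"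
    and B1: "\<And>v. v \<in> tangent_space \<A> p \<Longrightarrow> linear_within (tangent_space \<A> p) (\<lambda>u. B u v)"
    and B2: "\<And>u. u \<in> tangent_space \<A> p \<Longrightarrow> linear_within (tangent_space \<A> p) (B u)"
  shows "(\<Sum>u\<leftarrow>E. B u u) = (\<Sum>u\<leftarrow>F. B u u :: real)"
proof -
  let ?n = "length F"
  note ED = orthonormal_basisD[OF E] and FD = orthonormal_basisD[OF F]
  have "B (E ! j) (E ! j) =
      (\<Sum>i<?n. \<Sum>k<?n. (g p (F ! i) (E ! j) * g p (E ! j) (F ! k)) * B (F ! i) (F ! k))"
    if j: "j < length E" for j
  proof -
    let ?c = "\<lambda>i. g p (E ! j) (F ! i)"
    have Ej: "E ! j = (\<Sum>i<?n. ?c i *\<^sub>R F ! i)"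
      by (rule orthonormal_expand[OF F ED(1)[OF j]])
    have "B (E ! j) (E ! j) = B (\<Sum>i<?n. ?c i *\<^sub>R F ! i) (E ! j)"
      using Ej by simp
    also have "\<dots> = (\<Sum>i<?n. ?c i * B (F ! i) (E ! j))"
      using linear_within_sum[OF subspace_tangent_space B1[OF ED(1)[OF j]], of "{..<?n}"] FD(1) by simp
    also have "\<dots> = (\<Sum>i<?n. ?c i * B (F ! i) (\<Sum>k<?n. ?c k *\<^sub>R F ! k))"
      using Ej by simp
    also have "\<dots> = (\<Sum>i<?n. ?c i * (\<Sum>k<?n. ?c k * B (F ! i) (F ! k)))"
      using linear_within_sum[OF subspace_tangent_space B2[OF FD(1)], of _ "{..<?n}"] FD(1) by simp
    finally have "B (E ! j) (E ! j) = (\<Sum>i<?n. \<Sum>k<?n. (?c i * ?c k) * B (F ! i) (F ! k))"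
      by (simp add: sum_distrib_left mult.assoc)
    moreover have "?c i = g p (F ! i) (E ! j)" if "i < ?n" for i
      using g_sym[OF ED(1)[OF j] FD(1)[OF that]] .
    ultimately show ?thesis
      by simp
  qed
  then have "(\<Sum>u\<leftarrow>E. B u u) = (\<Sum>j<length E. \<Sum>i<?n. \<Sum>k<?n.
      (g p (F ! i) (E ! j) * g p (E ! j) (F ! k)) * B (F ! i) (F ! k))"
    by (simp add: sum_list_sum_nth atLeast0LessThan)
  also have "\<dots> = (\<Sum>i<?n. \<Sum>k<?n. (\<Sum>j<length E. g p (F ! i) (E ! j) * g p (E ! j) (F ! k)) * B (F ! i) (F ! k))"
    by (subst sum.swap, rule sum.cong[OF refl], subst sum.swap) (simp add: sum_distrib_right)
  also have "\<dots> = (\<Sum>i<?n. \<Sum>k<?n. (if i = k then B (F ! i) (F ! k) else 0))"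
  proof (intro sum.cong refl)
    fix i k assume ik: "i \<in> {..<?n}" "k \<in> {..<?n}"
    have "g p (F ! i) (F ! k) = g p (\<Sum>j<length E. g p (F ! i) (E ! j) *\<^sub>R E ! j) (F ! k)"
      using orthonormal_expand[OF E FD(1)[of i]] ik by simp
    also have "\<dots> = (\<Sum>j<length E. g p (F ! i) (E ! j) * g p (E ! j) (F ! k))"
      using linear_within_sum[OF subspace_tangent_space linear_within_g_left[OF FD(1)[of k]], of "{..<length E}" "\<lambda>j. E ! j"]
        ED(1) ik by simp
    finally show "(\<Sum>j<length E. g p (F ! i) (E ! j) * g p (E ! j) (F ! k)) * B (F ! i) (F ! k) =
        (if i = k then B (F ! i) (F ! k) else 0)"
      using FD(2)[of i k] ik by (cases "i = k") auto
  qed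
  also have "\<dots> = (\<Sum>u\<leftarrow>F. B u u)"
    by (simp add: sum_list_sum_nth atLeast0LessThan)
  finally show ?thesis .
qed

text \<open>The existence of one orthonormal basis makes the chosen basis orthonormal, and the trace
  does not depend on which one it is.\<close>

lemma metric_trace_eq:
  assumes "orthonormal_basis \<A> g p F"
    and "\<And>v. v \<in> tangent_space \<A> p \<Longrightarrow> linear_within (tangent_space \<A> p) (\<lambda>u. B u v)"
    and "\<And>u. u \<in> tangent_space \<A> p \<Longrightarrow> linear_within (tangent_space \<A> p) (B u)"
  shows "metric_trace \<A> g p B = (\<Sum>u\<leftarrow>F. B u u)"
  unfolding metric_trace_def
  by (rule orthonormal_trace_eq[OF someI[of "orthonormal_basis \<A> g p", OF assms(1)] assms])

lemma bilinear_eq_on_basis: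
  assumes F: "orthonormal_basis \<A> g p F"
    and "\<And>v. v \<in> tangent_space \<A> p \<Longrightarrow> linear_within (tangent_space \<A> p) (\<lambda>u. B u v)"
    and "\<And>u. u \<in> tangent_space \<A> p \<Longrightarrow> linear_within (tangent_space \<A> p) (B u)"
    and "\<And>v. v \<in> tangent_space \<A> p \<Longrightarrow> linear_within (tangent_space \<A> p) (\<lambda>u. C u v)"
    and "\<And>u. u \<in> tangent_space \<A> p \<Longrightarrow> linear_within (tangent_space \<A> p) (C u)"
    and eq: "\<And>i j. i < length F \<Longrightarrow> j < length F \<Longrightarrow> B (F ! i) (F ! j) = (C (F ! i) (F ! j) :: real)"
    and uv: "u \<in> tangent_space \<A> p" "v \<in> tangent_space \<A> p"
  shows "B u v = C u v"
proof -
  note FD = orthonormal_basisD[OF F]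
  have expand: "D u v = (\<Sum>i<length F. \<Sum>j<length F. g p u (F ! i) * g p v (F ! j) * D (F ! i) (F ! j))"
    if D: "\<And>v. v \<in> tangent_space \<A> p \<Longrightarrow> linear_within (tangent_space \<A> p) (\<lambda>u. D u v)"
      "\<And>u. u \<in> tangent_space \<A> p \<Longrightarrow> linear_within (tangent_space \<A> p) (D u)" for D :: "_ \<Rightarrow> _ \<Rightarrow> real"
  proof -
    have "D u v = D (\<Sum>i<length F. g p u (F ! i) *\<^sub>R F ! i) v"
      using orthonormal_expand[OF F uv(1)] by simp
    also have "\<dots> = (\<Sum>i<length F. g p u (F ! i) * D (F ! i) v)"
      using linear_within_sum[OF subspace_tangent_space D(1)[OF uv(2)], of "{..<length F}"] FD(1) by simp
    also have "\<dots> = (\<Sum>i<length F. g p u (F ! i) * D (F ! i) (\<Sum>j<length F. g p v (F ! j) *\<^sub>R F ! j))"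
      using orthonormal_expand[OF F uv(2)] by simp
    also have "\<dots> = (\<Sum>i<length F. g p u (F ! i) * (\<Sum>j<length F. g p v (F ! j) * D (F ! i) (F ! j)))"
      using linear_within_sum[OF subspace_tangent_space D(2)[OF FD(1)], of _ "{..<length F}"] FD(1) by simp
    finally show ?thesis by (simp add: sum_distrib_left mult.assoc)
  qed
  show ?thesis
    using expand[of B] expand[of C] assms(2-5) eq by simp
qed

end

section \<open>The Levi-Civita connection and its curvature\<close>

locale levi_civita_manifold = metric_manifold \<A> g
  for \<A> :: "('m::topological_space, 'e::euclidean_space) atlas" and g +
  fixes nab :: "'m connection"
  assumes lc: "levi_civita \<A> g nab"
begin

lemma affine: "affine_connection \<A> nab"
  using lc unfolding levi_civita_def by simp

context
  fixes W :: "'m set" and p assumes W: "open W" "p \<in> W"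
begin

lemma nab_tangent:
  "vector_field \<A> W Y \<Longrightarrow> u \<in> tangent_space \<A> p \<Longrightarrow> nab p u Y \<in> tangent_space \<A> p"
  using affine W unfolding affine_connection_def by simp

lemma nab_add_dir:
  "vector_field \<A> W Y \<Longrightarrow> u \<in> tangent_space \<A> p \<Longrightarrow> v \<in> tangent_space \<A> p \<Longrightarrow>
    nab p (u + v) Y = nab p u Y + nab p v Y"
  using affine W unfolding affine_connection_def by simp

lemma nab_scale_dir:
  "vector_field \<A> W Y \<Longrightarrow> u \<in> tangent_space \<A> p \<Longrightarrow> nab p (k *\<^sub>R u) Y = k *\<^sub>R nab p u Y"
  using affine W unfolding affine_connection_def by simp

lemma nab_add:
  assumes "vector_field \<A> W Y" "vector_field \<A> W Z" "u \<in> tangent_space \<A> p"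
  shows "nab p u (\<lambda>q. Y q + Z q) = nab p u Y + nab p u Z"
proof -
  have "nab p u (Y + Z) = nab p u Y + nab p u Z"
    using affine W assms unfolding affine_connection_def by simp
  then show ?thesis by (simp only: plus_fun_def[of Y Z])
qed

lemma nab_leibniz:
  "vector_field \<A> W Y \<Longrightarrow> smooth_fun \<A> W f \<Longrightarrow> u \<in> tangent_space \<A> p \<Longrightarrow>
    nab p u (\<lambda>q. f q *\<^sub>R Y q) = u f *\<^sub>R Y p + f p *\<^sub>R nab p u Y"
  using affine W unfolding affine_connection_def by simp

lemma torsion_free:
  "vector_field \<A> W X \<Longrightarrow> vector_field \<A> W Y \<Longrightarrow>
    bracket \<A> X Y p = nab p (X p) Y - nab p (Y p) X"
  using lc W unfolding levi_civita_def by simp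

lemma metric_compatible:
  "vector_field \<A> W X \<Longrightarrow> vector_field \<A> W Y \<Longrightarrow> u \<in> tangent_space \<A> p \<Longrightarrow>
    u (\<lambda>q. g q (X q) (Y q)) = g p (nab p u X) (Y p) + g p (X p) (nab p u Y)"
  using lc W unfolding levi_civita_def by simp

lemma nab_uminus_dir:
  "vector_field \<A> W Y \<Longrightarrow> u \<in> tangent_space \<A> p \<Longrightarrow> nab p (- u) Y = - nab p u Y"
  using nab_scale_dir[of Y u "-1"] by simp

lemma nab_diff_dir:
  "vector_field \<A> W Y \<Longrightarrow> u \<in> tangent_space \<A> p \<Longrightarrow> v \<in> tangent_space \<A> p \<Longrightarrow>
    nab p (u - v) Y = nab p u Y - nab p v Y"
  using nab_add_dir[of Y u "- v"] nab_uminus_dir[of Y v] tangent_space_uminus[of v p] by simp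

lemma nab_local:
  assumes Y: "vector_field \<A> W Y" "\<And>q. q \<in> W \<Longrightarrow> Y q = Y' q" and u: "u \<in> tangent_space \<A> p"
  shows "nab p u Y = nab p u Y'"
proof -
  let ?h = "indicat_real W"
  have h: "smooth_fun \<A> W ?h"
    by (rule smooth_fun_cong[OF W(1) _ smooth_fun_const[of W 1]]) simp
  have uh: "u ?h = 0" using tangent_indicator[OF u W] .
  have Y': "vector_field \<A> W Y'" using vector_field_cong[OF W(1) Y(2,1)] .
  \<comment> \<open>Both products vanish off \<open>W\<close>, so after scaling the fields are equal
    everywhere. The Leibniz rule then removes the factor, since \<open>u\<close> kills the
    indicator.\<close>
  have "?h q *\<^sub>R Y q = ?h q *\<^sub>R Y' q" for q
    using Y(2) by (cases "q \<in> W") simp_all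
  then have "(\<lambda>q. ?h q *\<^sub>R Y q) = (\<lambda>q. ?h q *\<^sub>R Y' q)"
    by (rule ext)
  then show ?thesis
    using nab_leibniz[OF Y(1) h u] nab_leibniz[OF Y' h u] uh W by simp
qed

end

lemma vector_field_nab:
  "open W \<Longrightarrow> vector_field \<A> W X \<Longrightarrow> vector_field \<A> W Y \<Longrightarrow> vector_field \<A> W (\<lambda>p. nab p (X p) Y)"
  using affine unfolding affine_connection_def by simp

text \<open>Torsion-freeness writes the bracket as a difference of covariant derivatives, whose
  smoothness is part of \<open>affine_connection\<close>; the same identity shows that its values
  are tangent vectors.\<close>

lemma vector_field_bracket:
  assumes "open W" "vector_field \<A> W X" "vector_field \<A> W Y"
  shows "vector_field \<A> W (bracket \<A> X Y)"
proof (rule vector_field_cong[OF assms(1)])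
  show "vector_field \<A> W (\<lambda>q. nab q (X q) Y + - nab q (Y q) X)"
    using assms by (intro vector_field_add vector_field_uminus vector_field_nab)
  show "nab q (X q) Y + - nab q (Y q) X = bracket \<A> X Y q" if "q \<in> W" for q
    using torsion_free[OF assms(1) that assms(2,3)] by simp
qed

section \<open>Tensoriality and symmetries of the curvature\<close>

context
  fixes W :: "'m set" and p assumes W: "open W" "p \<in> W"
begin

lemma curvature_swap:
  assumes "vector_field \<A> W X" "vector_field \<A> W Y" "vector_field \<A> W Z"
  shows "curvature \<A> nab X Y Z p = - curvature \<A> nab Y X Z p"
proof -
  have "bracket \<A> Y X p \<in> tangent_space \<A> p"
    using vector_fieldD[OF vector_field_bracket[OF W(1) assms(2,1)] W(2)] .
  then have "nab p (bracket \<A> X Y p) Z = - nab p (bracket \<A> Y X p) Z"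
    using nab_uminus_dir[OF W assms(3)] bracket_swap[of X Y p] by simp
  then show ?thesis by (simp add: curvature_def)
qed

lemma curvature_tangent:
  assumes "vector_field \<A> W X" "vector_field \<A> W Y" "vector_field \<A> W Z"
  shows "curvature \<A> nab X Y Z p \<in> tangent_space \<A> p"
  unfolding curvature_def
  using assms W by (intro tangent_space_diff nab_tangent vector_field_nab vector_fieldD vector_field_bracket)

lemma curvature_add_left:
  assumes X: "vector_field \<A> W X" "vector_field \<A> W X'"
    and Y: "vector_field \<A> W Y" and Z: "vector_field \<A> W Z"
  shows "curvature \<A> nab (\<lambda>q. X q + X' q) Y Z p = curvature \<A> nab X Y Z p + curvature \<A> nab X' Y Z p"
proof -
  note T = vector_fieldD[OF _ W(2)]
  \<comment> \<open>The inner derivative splits only at points of \<open>W\<close>, so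
    \<open>nab_local\<close> is needed before the outer derivative can be expanded.\<close>
  have "nab p (Y p) (\<lambda>q. nab q (X q + X' q) Z) = nab p (Y p) (\<lambda>q. nab q (X q) Z + nab q (X' q) Z)"
    by (rule nab_local[OF W vector_field_nab[OF W(1) vector_field_add[OF X] Z] _ T[OF Y]])
       (use nab_add_dir[OF W(1) _ Z] vector_fieldD X in metis)
  also have "\<dots> = nab p (Y p) (\<lambda>q. nab q (X q) Z) + nab p (Y p) (\<lambda>q. nab q (X' q) Z)"
    by (intro nab_add[OF W] vector_field_nab W X Z T Y)
  finally have 1: "nab p (Y p) (\<lambda>q. nab q (X q + X' q) Z) =
    nab p (Y p) (\<lambda>q. nab q (X q) Z) + nab p (Y p) (\<lambda>q. nab q (X' q) Z)" .
  have "bracket \<A> (\<lambda>q. X q + X' q) Y p = bracket \<A> X Y p + bracket \<A> X' Y p"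
    using bracket_add_right[OF W Y X] bracket_swap[of _ Y p] by simp
  then have 2: "nab p (bracket \<A> (\<lambda>q. X q + X' q) Y p) Z
      = nab p (bracket \<A> X Y p) Z + nab p (bracket \<A> X' Y p) Z"
    using nab_add_dir[OF W Z T[OF vector_field_bracket[OF W(1) X(1) Y]] T[OF vector_field_bracket[OF W(1) X(2) Y]]]
    by simp
  have 3: "nab p (X p + X' p) (\<lambda>q. nab q (Y q) Z) =
      nab p (X p) (\<lambda>q. nab q (Y q) Z) + nab p (X' p) (\<lambda>q. nab q (Y q) Z)"
    by (intro nab_add_dir[OF W] vector_field_nab W X Z T Y)
  show ?thesis
    unfolding curvature_def 1 2 3 by (simp only: algebra_simps)
qed

text \<open>The Leibniz rule under \<open>nab p (Y p)\<close> and the bracket with the scaled field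
  both contribute \<open>Y p f *\<^sub>R nab p (X p) Z\<close>, with opposite signs in the
  curvature.\<close>

lemma curvature_scale_left:
  assumes X: "vector_field \<A> W X" and f: "smooth_fun \<A> W f"
    and Y: "vector_field \<A> W Y" and Z: "vector_field \<A> W Z"
  shows "curvature \<A> nab (\<lambda>q. f q *\<^sub>R X q) Y Z p = f p *\<^sub>R curvature \<A> nab X Y Z p"
proof -
  note T = vector_fieldD[OF _ W(2)]
  have "nab p (Y p) (\<lambda>q. nab q (f q *\<^sub>R X q) Z) = nab p (Y p) (\<lambda>q. f q *\<^sub>R nab q (X q) Z)"
    by (rule nab_local[OF W vector_field_nab[OF W(1) vector_field_scale[OF f X] Z] _ T[OF Y]])
       (use nab_scale_dir[OF W(1) _ Z] vector_fieldD X in metis)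
  also have "\<dots> = Y p f *\<^sub>R nab p (X p) Z + f p *\<^sub>R nab p (Y p) (\<lambda>q. nab q (X q) Z)"
    by (rule nab_leibniz[OF W vector_field_nab[OF W(1) X Z] f T[OF Y]])
  finally have 1: "nab p (Y p) (\<lambda>q. nab q (f q *\<^sub>R X q) Z) =
    Y p f *\<^sub>R nab p (X p) Z + f p *\<^sub>R nab p (Y p) (\<lambda>q. nab q (X q) Z)" .
  have "bracket \<A> (\<lambda>q. f q *\<^sub>R X q) Y p = - (Y p f *\<^sub>R X p) + f p *\<^sub>R bracket \<A> X Y p"
    using bracket_scale_right[OF W Y X f] bracket_swap[of _ Y p] by simp
  then have 2: "nab p (bracket \<A> (\<lambda>q. f q *\<^sub>R X q) Y p) Z =
    f p *\<^sub>R nab p (bracket \<A> X Y p) Z - Y p f *\<^sub>R nab p (X p) Z"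
    using T[OF X] T[OF vector_field_bracket[OF W(1) X Y]]
    by (simp add: nab_diff_dir[OF W Z] nab_scale_dir[OF W Z] tangent_space_scale)
  have 3: "nab p (f p *\<^sub>R X p) (\<lambda>q. nab q (Y q) Z) = f p *\<^sub>R nab p (X p) (\<lambda>q. nab q (Y q) Z)"
    by (intro nab_scale_dir[OF W] vector_field_nab W X Z T Y)
  show ?thesis
    unfolding curvature_def 1 2 3 by (simp only: algebra_simps)
qed

lemma curvature_add_right:
  assumes X: "vector_field \<A> W X" and Y: "vector_field \<A> W Y"
    and Z: "vector_field \<A> W Z" "vector_field \<A> W Z'"
  shows "curvature \<A> nab X Y (\<lambda>q. Z q + Z' q) p = curvature \<A> nab X Y Z p + curvature \<A> nab X Y Z' p"
proof -
  note T = vector_fieldD[OF _ W(2)]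
  have 1: "nab p (P p) (\<lambda>q. nab q (Q q) (\<lambda>q. Z q + Z' q)) =
      nab p (P p) (\<lambda>q. nab q (Q q) Z) + nab p (P p) (\<lambda>q. nab q (Q q) Z')"
    if P: "vector_field \<A> W P" and Q: "vector_field \<A> W Q" for P Q
  proof -
    have "nab p (P p) (\<lambda>q. nab q (Q q) (\<lambda>q. Z q + Z' q)) =
        nab p (P p) (\<lambda>q. nab q (Q q) Z + nab q (Q q) Z')"
      by (rule nab_local[OF W vector_field_nab[OF W(1) Q vector_field_add[OF Z]] _ T[OF P]])
         (use nab_add[OF W(1) _ Z] vector_fieldD Q in metis)
    also have "\<dots> = nab p (P p) (\<lambda>q. nab q (Q q) Z) + nab p (P p) (\<lambda>q. nab q (Q q) Z')"
      by (intro nab_add[OF W] vector_field_nab W Q Z T P)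
    finally show ?thesis .
  qed
  have 2: "nab p (bracket \<A> X Y p) (\<lambda>q. Z q + Z' q)
      = nab p (bracket \<A> X Y p) Z + nab p (bracket \<A> X Y p) Z'"
    by (intro nab_add[OF W] T vector_field_bracket W X Y Z)
  show ?thesis
    unfolding curvature_def 2 1[OF X Y] 1[OF Y X] by (simp only: algebra_simps)
qed

text \<open>The second derivatives of \<open>f\<close> combine to the commutator, which the bracket
  term cancels; the products of first derivatives are symmetric in \<open>X\<close> and
  \<open>Y\<close> and drop out.\<close>

lemma curvature_scale_right:
  assumes X: "vector_field \<A> W X" and Y: "vector_field \<A> W Y"
    and f: "smooth_fun \<A> W f" and Z: "vector_field \<A> W Z"
  shows "curvature \<A> nab X Y (\<lambda>q. f q *\<^sub>R Z q) p = f p *\<^sub>R curvature \<A> nab X Y Z p"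
proof -
  note T = vector_fieldD[OF _ W(2)]
  have 1: "nab p (P p) (\<lambda>q. nab q (Q q) (\<lambda>q. f q *\<^sub>R Z q)) =
      P p (\<lambda>q. Q q f) *\<^sub>R Z p + Q p f *\<^sub>R nab p (P p) Z
      + (P p f *\<^sub>R nab p (Q p) Z + f p *\<^sub>R nab p (P p) (\<lambda>q. nab q (Q q) Z))"
    if P: "vector_field \<A> W P" and Q: "vector_field \<A> W Q" for P Q
  proof -
    note Qf = smooth_fun_vector_field[OF Q W(1) f] and QZ = vector_field_nab[OF W(1) Q Z]
    have "nab p (P p) (\<lambda>q. nab q (Q q) (\<lambda>q. f q *\<^sub>R Z q)) =
        nab p (P p) (\<lambda>q. Q q f *\<^sub>R Z q + f q *\<^sub>R nab q (Q q) Z)"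
      by (rule nab_local[OF W vector_field_nab[OF W(1) Q vector_field_scale[OF f Z]] _ T[OF P]])
         (use nab_leibniz[OF W(1) _ Z f] vector_fieldD Q in metis)
    also have "\<dots> = nab p (P p) (\<lambda>q. Q q f *\<^sub>R Z q) + nab p (P p) (\<lambda>q. f q *\<^sub>R nab q (Q q) Z)"
      by (rule nab_add[OF W vector_field_scale[OF Qf Z] vector_field_scale[OF f QZ] T[OF P]])
    finally show ?thesis
      using nab_leibniz[OF W Z Qf T[OF P]] nab_leibniz[OF W QZ f T[OF P]] by simp
  qed
  have 2: "nab p (bracket \<A> X Y p) (\<lambda>q. f q *\<^sub>R Z q)
      = (X p (\<lambda>q. Y q f) - Y p (\<lambda>q. X q f)) *\<^sub>R Z p + f p *\<^sub>R nab p (bracket \<A> X Y p) Z"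
    using nab_leibniz[OF W Z f T[OF vector_field_bracket[OF W(1) X Y]]]
      bracket_apply[OF smooth_nearI[OF W f]] by simp
  show ?thesis
    unfolding curvature_def 2 1[OF X Y] 1[OF Y X] by (simp only: algebra_simps)
qed

text \<open>Apply the bracket, as a commutator of derivations, to the function
  \<open>g(Z,U)\<close>. Expanding by metric compatibility, the terms with one derivative on each
  factor cancel and the rest are the two curvature terms.\<close>

lemma curvature_skew:
  assumes X: "vector_field \<A> W X" and Y: "vector_field \<A> W Y"
    and Z: "vector_field \<A> W Z" and U: "vector_field \<A> W U"
  shows "g p (curvature \<A> nab X Y Z p) (U p) = - g p (Z p) (curvature \<A> nab X Y U p)"
proof -
  note T = vector_fieldD[OF _ W(2)] and D = vector_field_nab[OF W(1)]
  let ?h = "\<lambda>q. g q (Z q) (U q)"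
  have h: "smooth_near \<A> p ?h"
    using smooth_nearI[OF W smooth_fun_g[OF W(1) Z U]] .
  have 1: "P p (\<lambda>q. Q q ?h) =
     g p (nab p (P p) (\<lambda>q. nab q (Q q) Z)) (U p) + g p (nab p (Q p) Z) (nab p (P p) U)
     + (g p (nab p (P p) Z) (nab p (Q p) U) + g p (Z p) (nab p (P p) (\<lambda>q. nab q (Q q) U)))"
    if P: "vector_field \<A> W P" and Q: "vector_field \<A> W Q" for P Q
  proof -
    have "P p (\<lambda>q. Q q ?h) = P p (\<lambda>q. g q (nab q (Q q) Z) (U q) + g q (Z q) (nab q (Q q) U))"
      by (rule tangent_local[OF T[OF P] W])
         (use metric_compatible[OF W(1) _ Z U] vector_fieldD[OF Q] in blast)
    also have "\<dots> = P p (\<lambda>q. g q (nab q (Q q) Z) (U q)) + P p (\<lambda>q. g q (Z q) (nab q (Q q) U))"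
      by (intro tangent_add[OF T[OF P]] smooth_nearI[OF W] smooth_fun_g W D Q Z U)
    finally show ?thesis
      using metric_compatible[OF W D[OF Q Z] U T[OF P]] metric_compatible[OF W Z D[OF Q U] T[OF P]]
      by simp
  qed
  have 2: "bracket \<A> X Y p ?h = g p (nab p (bracket \<A> X Y p) Z) (U p) + g p (Z p) (nab p (bracket \<A> X Y p) U)"
    by (rule metric_compatible[OF W Z U T[OF vector_field_bracket[OF W(1) X Y]]])
  have m: "nab p (bracket \<A> X Y p) Z \<in> tangent_space \<A> p" "nab p (bracket \<A> X Y p) U \<in> tangent_space \<A> p"
    by (intro nab_tangent[OF W] Z U T vector_field_bracket W X Y)+
  have m': "nab p (P p) (\<lambda>q. nab q (Q q) R) \<in> tangent_space \<A> p"
    if "vector_field \<A> W P" "vector_field \<A> W Q" "vector_field \<A> W R" for P Q R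
    by (intro nab_tangent[OF W] D T that)
  note mm = m m'[OF X Y Z] m'[OF Y X Z] m'[OF X Y U] m'[OF Y X U] T[OF Z] T[OF U]
  have "bracket \<A> X Y p ?h = X p (\<lambda>q. Y q ?h) - Y p (\<lambda>q. X q ?h)"
    by (rule bracket_apply[OF h])
  then show ?thesis
    unfolding 1[OF X Y] 1[OF Y X] 2 curvature_def
    by (simp add: g_diff_left g_diff_right tangent_space_diff mm)
qed

text \<open>Using torsion-freeness twice, the cyclic sum of curvatures regroups into a cyclic sum of
  nested brackets, which vanishes by the Jacobi identity.\<close>

lemma bianchi:
  assumes X: "vector_field \<A> W X" and Y: "vector_field \<A> W Y" and Z: "vector_field \<A> W Z"
  shows "curvature \<A> nab X Y Z p + curvature \<A> nab Y Z X p + curvature \<A> nab Z X Y p = 0"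
proof -
  note T = vector_fieldD[OF _ W(2)] and D = vector_field_nab[OF W(1)]
  have 1: "nab p (P p) (\<lambda>q. nab q (Q q) R) - nab p (P p) (\<lambda>q. nab q (R q) Q) - nab p (bracket \<A> Q R p) P
      = bracket \<A> P (bracket \<A> Q R) p"
    if P: "vector_field \<A> W P" and Q: "vector_field \<A> W Q" and R: "vector_field \<A> W R" for P Q R
  proof -
    note QR = vector_field_bracket[OF W(1) Q R]
    have "nab p (P p) (\<lambda>q. nab q (Q q) R) = nab p (P p) (\<lambda>q. nab q (R q) Q + bracket \<A> Q R q)"
      by (rule nab_local[OF W D[OF Q R] _ T[OF P]]) (simp add: torsion_free[OF W(1) _ Q R])
    also have "\<dots> = nab p (P p) (\<lambda>q. nab q (R q) Q) + nab p (P p) (bracket \<A> Q R)"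
      by (rule nab_add[OF W D[OF R Q] QR T[OF P]])
    finally show ?thesis
      using torsion_free[OF W P QR] by simp
  qed
  show ?thesis
    using jacobi[OF W X Y Z] 1[OF X Y Z] 1[OF Y Z X] 1[OF Z X Y]
    unfolding curvature_def by (simp add: algebra_simps)
qed

end

end

section \<open>Tensoriality and orthonormal frames\<close>

context smooth_manifold
begin

text \<open>
  Locality of \<open>T\<close> is implied: near \<open>p\<close> the indicator of a neighbourhood is smooth, so scaling by it
  does not change \<open>T X\<close>.
\<close>

definition tensorial_at :: "'m \<Rightarrow> ('m field \<Rightarrow> 'b::real_vector) \<Rightarrow> bool" where
  "tensorial_at p T \<longleftrightarrow> (\<exists>W. open W \<and> p \<in> W \<and>
     (\<forall>N X Y. open N \<longrightarrow> p \<in> N \<longrightarrow> N \<subseteq> W \<longrightarrow> vector_field \<A> N X \<longrightarrow> vector_field \<A> N Y \<longrightarrow>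
        T (\<lambda>q. X q + Y q) = T X + T Y) \<and>
     (\<forall>N X f. open N \<longrightarrow> p \<in> N \<longrightarrow> N \<subseteq> W \<longrightarrow> vector_field \<A> N X \<longrightarrow> smooth_fun \<A> N f \<longrightarrow>
        T (\<lambda>q. f q *\<^sub>R X q) = f p *\<^sub>R T X))"

lemma tensorial_atI:
  assumes "open W" "p \<in> W"
    and "\<And>N X Y. open N \<Longrightarrow> p \<in> N \<Longrightarrow> N \<subseteq> W \<Longrightarrow> vector_field \<A> N X \<Longrightarrow> vector_field \<A> N Y \<Longrightarrow>
        T (\<lambda>q. X q + Y q) = T X + T Y"
    and "\<And>N X f. open N \<Longrightarrow> p \<in> N \<Longrightarrow> N \<subseteq> W \<Longrightarrow> vector_field \<A> N X \<Longrightarrow> smooth_fun \<A> N f \<Longrightarrow>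
        T (\<lambda>q. f q *\<^sub>R X q) = f p *\<^sub>R T X"
  shows "tensorial_at p T"
  unfolding tensorial_at_def using assms by (intro exI[of _ W]) simp

lemma vector_field_sum:
  fixes n :: nat
  assumes "\<And>i. i < n \<Longrightarrow> smooth_fun \<A> N (c i)" "\<And>i. i < n \<Longrightarrow> vector_field \<A> N (E i)"
  shows "vector_field \<A> N (\<lambda>q. \<Sum>i<n. c i q *\<^sub>R E i q)"
  using assms
proof (induction n)
  case 0
  show ?case using vector_field_zero by (simp only: lessThan_0 sum.empty)
next
  case (Suc n)
  then show ?case
    unfolding sum.lessThan_Suc by (intro vector_field_add vector_field_scale) auto
qed

end

locale orthonormal_frame = metric_manifold \<A> g
  for \<A> :: "('m::topological_space, 'e::euclidean_space) atlas" and g +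
  fixes W :: "'m set" and n :: nat and E :: "nat \<Rightarrow> 'm field"
  assumes open_W: "open W"
    and frame_field: "\<And>i. i < n \<Longrightarrow> vector_field \<A> W (E i)"
    and frame_basis: "\<And>p. p \<in> W \<Longrightarrow> orthonormal_basis \<A> g p (map (\<lambda>i. E i p) [0..<n])"
begin

lemma frame_tangent: "p \<in> W \<Longrightarrow> i < n \<Longrightarrow> E i p \<in> tangent_space \<A> p"
  using vector_fieldD[OF frame_field] .

lemma frame_orthonormal: "p \<in> W \<Longrightarrow> i < n \<Longrightarrow> j < n \<Longrightarrow> g p (E i p) (E j p) = (if i = j then 1 else 0)"
  using orthonormal_basisD(2)[OF frame_basis, of p i j] by simp

lemma frame_expand:
  assumes "p \<in> W" "u \<in> tangent_space \<A> p"
  shows "u = (\<Sum>i<n. g p u (E i p) *\<^sub>R E i p)"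
proof -
  have "u = (\<Sum>i<length (map (\<lambda>i. E i p) [0..<n]).
      g p u (map (\<lambda>i. E i p) [0..<n] ! i) *\<^sub>R (map (\<lambda>i. E i p) [0..<n] ! i))"
    by (rule orthonormal_expand[OF frame_basis[OF assms(1)] assms(2)])
  also have "\<dots> = (\<Sum>i<n. g p u (E i p) *\<^sub>R E i p)"
    by (rule sum.cong) auto
  finally show ?thesis .
qed

text \<open>Near \<open>p\<close> the field \<open>X\<close> is a combination of frame fields with
  the smooth coefficients \<open>g(X, E i)\<close>, and linearity over smooth functions lets only
  their values at \<open>p\<close> survive.\<close>

lemma tensorial_expand:
  assumes p: "p \<in> W" and T: "tensorial_at p T" and N: "open N" "p \<in> N" and X: "vector_field \<A> N X"
  shows "T X = (\<Sum>i<n. g p (X p) (E i p) *\<^sub>R T (E i))"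
proof -
  obtain W' where W': "open W'" "p \<in> W'"
    and add: "\<And>N X Y. open N \<Longrightarrow> p \<in> N \<Longrightarrow> N \<subseteq> W' \<Longrightarrow> vector_field \<A> N X \<Longrightarrow>
        vector_field \<A> N Y \<Longrightarrow> T (\<lambda>q. X q + Y q) = T X + T Y"
    and scale: "\<And>N X f. open N \<Longrightarrow> p \<in> N \<Longrightarrow> N \<subseteq> W' \<Longrightarrow> vector_field \<A> N X \<Longrightarrow>
        smooth_fun \<A> N f \<Longrightarrow> T (\<lambda>q. f q *\<^sub>R X q) = f p *\<^sub>R T X"
    using T unfolding tensorial_at_def by auto
  define M where "M = N \<inter> W \<inter> W'"
  have M: "open M" "p \<in> M" "M \<subseteq> N" "M \<subseteq> W" "M \<subseteq> W'"
    unfolding M_def using N W' p open_W by auto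
  note add = add[OF M(1,2,5)] and scale = scale[OF M(1,2,5)]
  have XM: "vector_field \<A> M X" using vector_field_subset[OF X M(3)] .
  have EM: "vector_field \<A> M (E i)" if "i < n" for i
    using vector_field_subset[OF frame_field[OF that] M(4)] .
  let ?c = "\<lambda>i q. g q (X q) (E i q)"
  have c: "smooth_fun \<A> M (?c i)" if "i < n" for i
    using smooth_fun_g[OF M(1) XM EM[OF that]] .
  let ?S = "\<lambda>k q. \<Sum>i<k. ?c i q *\<^sub>R E i q"
  let ?h = "indicat_real M"
  have h: "smooth_fun \<A> M ?h"
    by (rule smooth_fun_cong[OF M(1) _ smooth_fun_const[of M 1]]) simp
  \<comment> \<open>The expansion of \<open>X\<close> holds on \<open>M\<close> only. Scaling both
    sides by the indicator makes them equal as total functions, and \<open>T\<close> does not notice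
    the factor because it is 1 at \<open>p\<close>.\<close>
  have "?h q *\<^sub>R X q = ?h q *\<^sub>R ?S n q" for q
  proof (cases "q \<in> M")
    case True
    then show ?thesis
      using frame_expand[of q "X q"] M(4) vector_fieldD[OF XM True] by auto
  qed simp
  then have "(\<lambda>q. ?h q *\<^sub>R X q) = (\<lambda>q. ?h q *\<^sub>R ?S n q)"
    by (rule ext)
  then have "T X = T (?S n)"
    using scale[OF XM h] scale[OF vector_field_sum[of n M ?c E, OF c EM] h] M(2) by simp
  also have "T (?S k) = (\<Sum>i<k. ?c i p *\<^sub>R T (E i))" if "k \<le> n" for k
    using that
  proof (induction k)
    case 0
    have "T (\<lambda>q. 0) = 0"
      using scale[OF vector_field_zero smooth_fun_const[of M 0]] by simp
    then show ?case by (simp only: lessThan_0 sum.empty)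
  next
    case (Suc k)
    have "T (?S (Suc k)) = T (?S k) + T (\<lambda>q. ?c k q *\<^sub>R E k q)"
      unfolding sum.lessThan_Suc
      using Suc.prems by (intro add vector_field_sum vector_field_scale c EM) auto
    also have "\<dots> = (\<Sum>i<Suc k. ?c i p *\<^sub>R T (E i))"
      using Suc scale[OF EM c, of k k] by simp
    finally show ?case .
  qed
  finally show ?thesis by simp
qed

lemma tensorial_cong:
  assumes p: "p \<in> W" and T: "tensorial_at p T"
    and X: "open N" "p \<in> N" "vector_field \<A> N X" and Y: "open M" "p \<in> M" "vector_field \<A> M Y"
    and eq: "X p = Y p"
  shows "T X = T Y"
  using tensorial_expand[OF p T X] tensorial_expand[OF p T Y] eq by simp

lemma extend_frame:
  assumes p: "p \<in> W" and u: "u \<in> tangent_space \<A> p"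
  shows "extend \<A> p u p = u" and "\<exists>N. open N \<and> p \<in> N \<and> N \<subseteq> W \<and> vector_field \<A> N (extend \<A> p u)"
proof -
  \<comment> \<open>Constant coefficients in the frame give a field with value \<open>u\<close> at
    \<open>p\<close>, which witnesses the choice in \<open>extend\<close>.\<close>
  let ?X = "\<lambda>q. \<Sum>i<n. g p u (E i p) *\<^sub>R E i q"
  have "vector_field \<A> W ?X"
    by (intro vector_field_sum smooth_fun_const frame_field)
  then have "(\<exists>N. open N \<and> p \<in> N \<and> vector_field \<A> N ?X) \<and> ?X p = u"
    using open_W p frame_expand[OF p u] by auto
  then have *: "(\<exists>N. open N \<and> p \<in> N \<and> vector_field \<A> N (extend \<A> p u)) \<and> extend \<A> p u p = u"
    unfolding extend_def
    by (rule someI[where P = "\<lambda>X. (\<exists>N. open N \<and> p \<in> N \<and> vector_field \<A> N X) \<and> X p = u"])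
  then show "extend \<A> p u p = u" by simp
  obtain N where "open N" "p \<in> N" "vector_field \<A> N (extend \<A> p u)"
    using * by blast
  then show "\<exists>N. open N \<and> p \<in> N \<and> N \<subseteq> W \<and> vector_field \<A> N (extend \<A> p u)"
    using open_W p vector_field_subset[of \<A> N "extend \<A> p u" "N \<inter> W"] by (intro exI[of _ "N \<inter> W"]) auto
qed

lemma extend_frameE:
  assumes "p \<in> W" "u \<in> tangent_space \<A> p"
  obtains N where "open N" "p \<in> N" "N \<subseteq> W" "vector_field \<A> N (extend \<A> p u)"
  using extend_frame(2)[OF assms] by auto

text \<open>Lets the arbitrary extension of a tangent vector be exchanged for a field suited to
  computation, such as a member of the frame.\<close>

lemma tensorial_extend:
  assumes p: "p \<in> W" and T: "tensorial_at p T" and X: "open N" "p \<in> N" "vector_field \<A> N X"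
  shows "T (extend \<A> p (X p)) = T X"
proof -
  have u: "X p \<in> tangent_space \<A> p" using vector_fieldD[OF X(3,2)] .
  obtain M where "open M" "p \<in> M" "M \<subseteq> W" "vector_field \<A> M (extend \<A> p (X p))"
    using extend_frameE[OF p u] .
  then show ?thesis
    using tensorial_cong[OF p T _ _ _ X] extend_frame(1)[OF p u] by blast
qed

text \<open>The choice in \<open>extend\<close> need not be linear in \<open>u\<close>. After
  expansion in the frame, however, \<open>u\<close> enters only through its components.\<close>

lemma tensorial_linear:
  assumes p: "p \<in> W" and T: "tensorial_at p T"
  shows "linear_within (tangent_space \<A> p) (\<lambda>u. T (extend \<A> p u))"
proof -
  have *: "T (extend \<A> p u) = (\<Sum>i<n. g p u (E i p) *\<^sub>R T (E i))" if u: "u \<in> tangent_space \<A> p" for u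
  proof -
    obtain M where M: "open M" "p \<in> M" "M \<subseteq> W" "vector_field \<A> M (extend \<A> p u)"
      using extend_frameE[OF p u] .
    show ?thesis
      using tensorial_expand[OF p T M(1,2,4)] extend_frame(1)[OF p u] by simp
  qed
  show ?thesis
    by (rule linear_withinI)
       (simp_all add: * tangent_space_add tangent_space_scale g_add_left g_scale_left frame_tangent[OF p]
         scaleR_add_left sum.distrib scaleR_sum_right)
qed

lemma metric_trace_frame:
  assumes "p \<in> W"
    and "\<And>v. v \<in> tangent_space \<A> p \<Longrightarrow> linear_within (tangent_space \<A> p) (\<lambda>u. B u v)"
    and "\<And>u. u \<in> tangent_space \<A> p \<Longrightarrow> linear_within (tangent_space \<A> p) (B u)"
  shows "metric_trace \<A> g p B = (\<Sum>i<n. B (E i p) (E i p))"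
  using metric_trace_eq[OF frame_basis[OF assms(1)] assms(2,3)]
  by (simp add: sum_list_sum_nth atLeast0LessThan)

end

context levi_civita_manifold
begin

lemma tensorial_curvature_1:
  assumes W: "open W" "p \<in> W" and Y: "vector_field \<A> W Y" and Z: "vector_field \<A> W Z"
  shows "tensorial_at p (\<lambda>X. curvature \<A> nab X Y Z p)"
  by (rule tensorial_atI[OF W])
     (simp_all add: curvature_add_left curvature_scale_left vector_field_subset[OF Y] vector_field_subset[OF Z])

text \<open>Antisymmetry carries the first slot over to the second.\<close>

lemma tensorial_curvature_2:
  assumes W: "open W" "p \<in> W" and X: "vector_field \<A> W X" and Z: "vector_field \<A> W Z"
  shows "tensorial_at p (\<lambda>Y. curvature \<A> nab X Y Z p)"
proof (rule tensorial_atI[OF W])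
  fix N Y Y' assume N: "open N" "p \<in> N" "N \<subseteq> W" and Y: "vector_field \<A> N Y" "vector_field \<A> N Y'"
  note X' = vector_field_subset[OF X N(3)] and Z' = vector_field_subset[OF Z N(3)]
  note swap = curvature_swap[OF N(1,2) X' _ Z']
  show "curvature \<A> nab X (\<lambda>q. Y q + Y' q) Z p = curvature \<A> nab X Y Z p + curvature \<A> nab X Y' Z p"
    unfolding swap[OF vector_field_add[OF Y]] swap[OF Y(1)] swap[OF Y(2)]
      curvature_add_left[OF N(1,2) Y X' Z'] by simp
next
  fix N Y f assume N: "open N" "p \<in> N" "N \<subseteq> W" and Y: "vector_field \<A> N Y" and f: "smooth_fun \<A> N f"
  note X' = vector_field_subset[OF X N(3)] and Z' = vector_field_subset[OF Z N(3)]
  note swap = curvature_swap[OF N(1,2) X' _ Z']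
  show "curvature \<A> nab X (\<lambda>q. f q *\<^sub>R Y q) Z p = f p *\<^sub>R curvature \<A> nab X Y Z p"
    unfolding swap[OF vector_field_scale[OF f Y]] swap[OF Y]
      curvature_scale_left[OF N(1,2) Y f X' Z'] by simp
qed

lemma tensorial_curvature_3:
  assumes W: "open W" "p \<in> W" and X: "vector_field \<A> W X" and Y: "vector_field \<A> W Y"
  shows "tensorial_at p (\<lambda>Z. curvature \<A> nab X Y Z p)"
  by (rule tensorial_atI[OF W])
     (simp_all add: curvature_add_right curvature_scale_right vector_field_subset[OF X] vector_field_subset[OF Y])

end

section \<open>Ricci tensor, scalar curvature and Lie derivative of the metric in a frame\<close>

locale levi_civita_frame = levi_civita_manifold \<A> g nab + orthonormal_frame \<A> g W n E
  for \<A> :: "('m::topological_space, 'e::euclidean_space) atlas" and g nab W n E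
begin

text \<open>The three extensions are exchanged one slot at a time; at each exchange the other two
  slots hold fields that are smooth on a common neighbourhood.\<close>

lemma curvature_extend:
  assumes p: "p \<in> W" and N: "open N" "p \<in> N"
    and X: "vector_field \<A> N X" and Y: "vector_field \<A> N Y" and Z: "vector_field \<A> N Z"
  shows "curvature \<A> nab (extend \<A> p (X p)) (extend \<A> p (Y p)) (extend \<A> p (Z p)) p
    = curvature \<A> nab X Y Z p"
proof -
  note T = vector_fieldD[OF _ N(2)]
  obtain M1 where M1: "open M1" "p \<in> M1" "M1 \<subseteq> W" "vector_field \<A> M1 (extend \<A> p (X p))"
    using extend_frameE[OF p T[OF X]] .
  obtain M2 where M2: "open M2" "p \<in> M2" "M2 \<subseteq> W" "vector_field \<A> M2 (extend \<A> p (Y p))"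
    using extend_frameE[OF p T[OF Y]] .
  define M where "M = M1 \<inter> M2 \<inter> N"
  have M: "open M" "p \<in> M"
    unfolding M_def using M1 M2 N by auto
  have X1: "vector_field \<A> M (extend \<A> p (X p))" and Y1: "vector_field \<A> M (extend \<A> p (Y p))"
    and Z': "vector_field \<A> M Z"
    unfolding M_def
    by (rule vector_field_subset[OF M1(4)] vector_field_subset[OF M2(4)] vector_field_subset[OF Z]; blast)+
  have "curvature \<A> nab (extend \<A> p (X p)) (extend \<A> p (Y p)) (extend \<A> p (Z p)) p
     = curvature \<A> nab (extend \<A> p (X p)) (extend \<A> p (Y p)) Z p"
    by (rule tensorial_extend[OF p tensorial_curvature_3[OF M X1 Y1] N Z])
  also have "\<dots> = curvature \<A> nab (extend \<A> p (X p)) Y Z p"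
    by (rule tensorial_extend[OF p tensorial_curvature_2[OF M X1 Z'] N Y])
  also have "\<dots> = curvature \<A> nab X Y Z p"
    by (rule tensorial_extend[OF p tensorial_curvature_1[OF N Y Z] N X])
  finally show ?thesis .
qed

text \<open>Removes both choices from \<open>Ric\<close>: the trace is taken over the given frame,
  and the curvature is evaluated on actual fields instead of chosen extensions.\<close>

lemma Ric_frame:
  assumes p: "p \<in> W" and N: "open N" "p \<in> N" and X: "vector_field \<A> N X" and Y: "vector_field \<A> N Y"
  shows "Ric \<A> g nab p (X p) (Y p) = (\<Sum>i<n. g p (curvature \<A> nab (E i) X Y p) (E i p))"
proof -
  note T = vector_fieldD[OF _ N(2)]
  let ?R = "\<lambda>u. curvature \<A> nab (extend \<A> p u) (extend \<A> p (X p)) (extend \<A> p (Y p)) p"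
  have R: "?R u = curvature \<A> nab (extend \<A> p u) X Y p" if u: "u \<in> tangent_space \<A> p" for u
  proof -
    obtain M where M: "open M" "p \<in> M" "M \<subseteq> W" "vector_field \<A> M (extend \<A> p u)"
      using extend_frameE[OF p u] .
    have "open (M \<inter> N)" "p \<in> M \<inter> N" using M N by auto
    from curvature_extend[OF p this vector_field_subset[OF M(4)] vector_field_subset[OF X] vector_field_subset[OF Y]]
    show ?thesis using extend_frame(1)[OF p u] by simp
  qed
  have lin: "linear_within (tangent_space \<A> p) ?R"
    using tensorial_linear[OF p tensorial_curvature_1[OF N X Y]] R
    unfolding linear_within_def by (simp add: tangent_space_add tangent_space_scale)
  have RT: "?R u \<in> tangent_space \<A> p" if u: "u \<in> tangent_space \<A> p" for u
  proof -
    obtain M where M: "open M" "p \<in> M" "M \<subseteq> W" "vector_field \<A> M (extend \<A> p u)"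
      using extend_frameE[OF p u] .
    have "open (M \<inter> N)" "p \<in> M \<inter> N" using M N by auto
    from curvature_tangent[OF this vector_field_subset[OF M(4)] vector_field_subset[OF X] vector_field_subset[OF Y]]
    show ?thesis unfolding R[OF u] by simp
  qed
  have "Ric \<A> g nab p (X p) (Y p) = (\<Sum>i<n. g p (?R (E i p)) (E i p))"
    unfolding Ric_def
  proof (rule metric_trace_frame[OF p])
    fix v assume v: "v \<in> tangent_space \<A> p"
    show "linear_within (tangent_space \<A> p) (\<lambda>u. g p (?R u) v)"
      using lin v RT unfolding linear_within_def by (simp add: g_add_left g_scale_left)
  next
    fix u assume u: "u \<in> tangent_space \<A> p"
    show "linear_within (tangent_space \<A> p) (g p (?R u))"
      by (rule linear_within_g_right[OF RT[OF u]])
  qed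
  also have "\<dots> = (\<Sum>i<n. g p (curvature \<A> nab (E i) X Y p) (E i p))"
  proof (rule sum.cong[OF refl])
    fix i assume "i \<in> {..<n}"
    then have i: "i < n" by simp
    have "open (W \<inter> N)" "p \<in> W \<inter> N" using N p open_W by auto
    from curvature_extend[OF p this vector_field_subset[OF frame_field[OF i]] vector_field_subset[OF X] vector_field_subset[OF Y]]
    show "g p (?R (E i p)) (E i p) = g p (curvature \<A> nab (E i) X Y p) (E i p)" by simp
  qed
  finally show ?thesis .
qed

lemma Ric_extend:
  assumes p: "p \<in> W" and u: "u \<in> tangent_space \<A> p" and v: "v \<in> tangent_space \<A> p"
  shows "Ric \<A> g nab p u v = (\<Sum>i<n. g p (curvature \<A> nab (E i) (extend \<A> p u) (extend \<A> p v) p) (E i p))"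
proof -
  obtain M1 where M1: "open M1" "p \<in> M1" "M1 \<subseteq> W" "vector_field \<A> M1 (extend \<A> p u)"
    using extend_frameE[OF p u] .
  obtain M2 where M2: "open M2" "p \<in> M2" "M2 \<subseteq> W" "vector_field \<A> M2 (extend \<A> p v)"
    using extend_frameE[OF p v] .
  have "open (M1 \<inter> M2)" "p \<in> M1 \<inter> M2" using M1 M2 by auto
  from Ric_frame[OF p this vector_field_subset[OF M1(4)] vector_field_subset[OF M2(4)]]
  show ?thesis
    by (simp add: extend_frame(1)[OF p u] extend_frame(1)[OF p v])
qed

lemma tensorial_g:
  assumes p: "p \<in> W" and T: "tensorial_at p T" and w: "w \<in> tangent_space \<A> p"
    and N: "open N" "p \<in> N" and "\<And>M X. open M \<Longrightarrow> p \<in> M \<Longrightarrow> M \<subseteq> N \<Longrightarrow> vector_field \<A> M X \<Longrightarrow> T X \<in> tangent_space \<A> p"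
  shows "tensorial_at p (\<lambda>X. g p (T X) w)"
proof -
  obtain W' where W': "open W'" "p \<in> W'"
    and add: "\<And>N X Y. open N \<Longrightarrow> p \<in> N \<Longrightarrow> N \<subseteq> W' \<Longrightarrow> vector_field \<A> N X \<Longrightarrow>
        vector_field \<A> N Y \<Longrightarrow> T (\<lambda>q. X q + Y q) = T X + T Y"
    and scale: "\<And>N X f. open N \<Longrightarrow> p \<in> N \<Longrightarrow> N \<subseteq> W' \<Longrightarrow> vector_field \<A> N X \<Longrightarrow>
        smooth_fun \<A> N f \<Longrightarrow> T (\<lambda>q. f q *\<^sub>R X q) = f p *\<^sub>R T X"
    using T unfolding tensorial_at_def by auto
  have "open (N \<inter> W')" "p \<in> N \<inter> W'" using N W' by auto
  then show ?thesis
    by (rule tensorial_atI) (simp_all add: add scale assms g_add_left g_scale_left)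
qed

lemma linear_within_Ric:
  assumes p: "p \<in> W" and v: "v \<in> tangent_space \<A> p"
  shows "linear_within (tangent_space \<A> p) (\<lambda>u. Ric \<A> g nab p u v)"
    and "linear_within (tangent_space \<A> p) (Ric \<A> g nab p v)"
proof -
  obtain N where N: "open N" "p \<in> N" "N \<subseteq> W" "vector_field \<A> N (extend \<A> p v)"
    using extend_frameE[OF p v] .
  have E: "vector_field \<A> N (E i)" if "i < n" for i
    using vector_field_subset[OF frame_field[OF that] N(3)] .
  have 1: "tensorial_at p (\<lambda>X. g p (curvature \<A> nab (E i) X (extend \<A> p v) p) (E i p))" if i: "i < n" for i
    by (rule tensorial_g[OF p tensorial_curvature_2[OF N(1,2) E[OF i] N(4)] frame_tangent[OF p i] N(1,2)])
       (meson curvature_tangent vector_field_subset E[OF i] N(4))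
  have 2: "tensorial_at p (\<lambda>X. g p (curvature \<A> nab (E i) (extend \<A> p v) X p) (E i p))" if i: "i < n" for i
    by (rule tensorial_g[OF p tensorial_curvature_3[OF N(1,2) E[OF i] N(4)] frame_tangent[OF p i] N(1,2)])
       (meson curvature_tangent vector_field_subset E[OF i] N(4))
  have "linear_within (tangent_space \<A> p)
      (\<lambda>u. \<Sum>i<n. g p (curvature \<A> nab (E i) (extend \<A> p u) (extend \<A> p v) p) (E i p))"
    by (rule linear_within_sum_fun) (use tensorial_linear[OF p 1] in simp)
  then show "linear_within (tangent_space \<A> p) (\<lambda>u. Ric \<A> g nab p u v)"
    using Ric_extend[OF p _ v] unfolding linear_within_def by (simp add: tangent_space_add tangent_space_scale)
  have "linear_within (tangent_space \<A> p)
      (\<lambda>u. \<Sum>i<n. g p (curvature \<A> nab (E i) (extend \<A> p v) (extend \<A> p u) p) (E i p))"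
    by (rule linear_within_sum_fun) (use tensorial_linear[OF p 2] in simp)
  then show "linear_within (tangent_space \<A> p) (Ric \<A> g nab p v)"
    using Ric_extend[OF p v] unfolding linear_within_def by (simp add: tangent_space_add tangent_space_scale)
qed

lemma scalar_curvature_frame:
  "p \<in> W \<Longrightarrow> scalar_curvature \<A> g nab p = (\<Sum>i<n. Ric \<A> g nab p (E i p) (E i p))"
  unfolding scalar_curvature_def
  by (intro metric_trace_frame linear_within_Ric)

text \<open>Metric compatibility expands the derivative of \<open>g(X,Y)\<close> along
  \<open>V\<close>, and torsion-freeness expands the two brackets. The derivatives of the extensions
  along \<open>V\<close> cancel, and only their values at \<open>p\<close> remain.\<close>

lemma lie_metric_eq:
  assumes p: "p \<in> W" and V: "vector_field \<A> W V"
    and u: "u \<in> tangent_space \<A> p" and v: "v \<in> tangent_space \<A> p"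
  shows "lie_metric \<A> V g p u v = g p (nab p u V) v + g p u (nab p v V)"
proof -
  obtain M1 where M1: "open M1" "p \<in> M1" "M1 \<subseteq> W" "vector_field \<A> M1 (extend \<A> p u)"
    using extend_frameE[OF p u] .
  obtain M2 where M2: "open M2" "p \<in> M2" "M2 \<subseteq> W" "vector_field \<A> M2 (extend \<A> p v)"
    using extend_frameE[OF p v] .
  let ?M = "M1 \<inter> M2" and ?X = "extend \<A> p u" and ?Y = "extend \<A> p v"
  have M: "open ?M" "p \<in> ?M" using M1 M2 by auto
  have X: "vector_field \<A> ?M ?X" and Y: "vector_field \<A> ?M ?Y" and V': "vector_field \<A> ?M V"
    using M1(3) by (auto intro!: vector_field_subset[OF M1(4)] vector_field_subset[OF M2(4)] vector_field_subset[OF V])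
  note Vp = vector_fieldD[OF V p] and ext = extend_frame(1)[OF p u] extend_frame(1)[OF p v]
  note nt = nab_tangent[OF M]
  show ?thesis
    using metric_compatible[OF M X Y Vp] torsion_free[OF M V' X] torsion_free[OF M V' Y]
    by (simp add: lie_metric_def Let_def ext g_diff_left g_diff_right nt X Y V' Vp u v)
qed

lemma linear_within_lie_metric:
  assumes p: "p \<in> W" and V: "vector_field \<A> W V" and v: "v \<in> tangent_space \<A> p"
  shows "linear_within (tangent_space \<A> p) (\<lambda>u. lie_metric \<A> V g p u v)"
    and "linear_within (tangent_space \<A> p) (lie_metric \<A> V g p v)"
  using v
  by (auto intro!: linear_withinI simp: lie_metric_eq[OF p V] tangent_space_add tangent_space_scale
      g_add_left g_scale_left g_add_right g_scale_right nab_add_dir[OF open_W p V]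
      nab_scale_dir[OF open_W p V] nab_tangent[OF open_W p V] algebra_simps)

lemma soliton_on_frame:
  assumes V: "vector_field \<A> W V"
  shows "almost_rb_soliton_on \<A> g nab W V lam rho \<longleftrightarrow>
    (\<forall>p\<in>W. \<forall>i<n. \<forall>j<n. Ric \<A> g nab p (E i p) (E j p)
        + (1/2) * (g p (nab p (E i p) V) (E j p) + g p (E i p) (nab p (E j p) V))
      = (if i = j then lam p + rho * scalar_curvature \<A> g nab p else 0))"
    (is "_ = (\<forall>p\<in>W. ?F p)")
proof
  assume "almost_rb_soliton_on \<A> g nab W V lam rho"
  then show "\<forall>p\<in>W. ?F p"
    unfolding almost_rb_soliton_on_def
    by (auto simp: frame_tangent frame_orthonormal lie_metric_eq[OF _ V])
next
  assume F: "\<forall>p\<in>W. ?F p"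
  show "almost_rb_soliton_on \<A> g nab W V lam rho"
    unfolding almost_rb_soliton_on_def
  proof (intro ballI)
    fix p u v assume p: "p \<in> W" and u: "u \<in> tangent_space \<A> p" and v: "v \<in> tangent_space \<A> p"
    \<comment> \<open>On the reals \<open>*\<^sub>R\<close> is multiplication; it is written this
      way to match \<open>linear_within_scale\<close>.\<close>
    let ?B = "\<lambda>u v. Ric \<A> g nab p u v + (1/2) *\<^sub>R lie_metric \<A> V g p u v"
    let ?C = "\<lambda>u v. (lam p + rho * scalar_curvature \<A> g nab p) *\<^sub>R g p u v"
    have "?B u v = ?C u v"
    proof (rule bilinear_eq_on_basis[OF frame_basis[OF p] _ _ _ _ _ u v])
      fix w assume w: "w \<in> tangent_space \<A> p"
      show "linear_within (tangent_space \<A> p) (\<lambda>u. ?B u w)"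
        "linear_within (tangent_space \<A> p) (?B w)"
        by (intro linear_within_add linear_within_scale linear_within_Ric linear_within_lie_metric p V w)+
      show "linear_within (tangent_space \<A> p) (\<lambda>u. ?C u w)"
        "linear_within (tangent_space \<A> p) (?C w)"
        by (intro linear_within_scale linear_within_g_left linear_within_g_right w)+
    qed (use F p in \<open>auto simp: frame_tangent frame_orthonormal lie_metric_eq[OF _ V]\<close>)
    then show "Ric \<A> g nab p u v + (1/2) * lie_metric \<A> V g p u v
        = (lam p + rho * scalar_curvature \<A> g nab p) * g p u v"
      by simp
  qed
qed

end

section \<open>Contact metric three-manifolds\<close>

lemma sum_less_3: "(\<Sum>i<3. f i) = f 0 + f 1 + f 2" for f :: "nat \<Rightarrow> 'b::comm_monoid_add"
  by (simp add: numeral_3_eq_3 numeral_2_eq_2)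

lemma all_less_3: "(\<forall>i<3. P i) \<longleftrightarrow> P 0 \<and> P 1 \<and> P (2::nat)"
  by (auto simp: numeral_3_eq_3 numeral_2_eq_2 less_Suc_eq)

locale contact_frame =
  fixes \<A> :: "('m::{t2_space, second_countable_topology}, real^3) atlas"
    and \<phi> :: "'m endo" and \<xi> :: "'m field" and \<eta> :: "'m one_form" and g :: "'m metric"
    and nab :: "'m connection" and W :: "'m set" and e :: "'m field" and ell :: "'m \<Rightarrow> real"
  assumes contact: "contact_metric_3_manifold \<A> \<phi> \<xi> \<eta> g"
    and nab: "levi_civita \<A> g nab"
    and W: "open W"
    and e: "vector_field \<A> W e"
    and basis: "\<And>p. p \<in> W \<Longrightarrow> orthonormal_basis \<A> g p [e p, \<phi> p (e p), \<xi> p]"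
    and ell: "smooth_fun \<A> W ell"
    and h_e: "\<And>p. p \<in> W \<Longrightarrow> contact_h \<A> \<phi> \<xi> p (e p) = ell p *\<^sub>R e p"
begin

definition e' :: "'m field" where "e' = (\<lambda>q. \<phi> q (e q))"

lemma endo_phi: "smooth_endo \<A> \<phi>"
  using contact unfolding contact_metric_3_manifold_def by blast

lemma phi_field: "open N \<Longrightarrow> vector_field \<A> N X \<Longrightarrow> vector_field \<A> N (\<lambda>q. \<phi> q (X q))"
  using endo_phi unfolding smooth_endo_def by simp

lemma phi_tangent: "u \<in> tangent_space \<A> p \<Longrightarrow> \<phi> p u \<in> tangent_space \<A> p"
  using endo_phi unfolding smooth_endo_def by simp

lemma phi_add:
  "u \<in> tangent_space \<A> p \<Longrightarrow> v \<in> tangent_space \<A> p \<Longrightarrow> \<phi> p (u + v) = \<phi> p u + \<phi> p v"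
  using endo_phi unfolding smooth_endo_def by simp

lemma phi_scale: "u \<in> tangent_space \<A> p \<Longrightarrow> \<phi> p (k *\<^sub>R u) = k *\<^sub>R \<phi> p u"
  using endo_phi unfolding smooth_endo_def by simp

lemma xi_field: "vector_field \<A> N \<xi>"
proof (rule vector_field_subset)
  show "vector_field \<A> UNIV \<xi>"
    using contact unfolding contact_metric_3_manifold_def by blast
qed simp

lemma e'_field: "vector_field \<A> W e'"
  unfolding e'_def by (rule phi_field[OF W e])

lemma eta_g: "u \<in> tangent_space \<A> p \<Longrightarrow> \<eta> p u = g p u (\<xi> p)"
  using contact unfolding contact_metric_3_manifold_def by simp

lemma phi_phi: "u \<in> tangent_space \<A> p \<Longrightarrow> \<phi> p (\<phi> p u) = - u + \<eta> p u *\<^sub>R \<xi> p"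
  using contact unfolding contact_metric_3_manifold_def by simp

lemma d_eta:
  "open N \<Longrightarrow> vector_field \<A> N X \<Longrightarrow> vector_field \<A> N Y \<Longrightarrow> p \<in> N \<Longrightarrow>
    d_one_form \<A> \<eta> X Y p = g p (X p) (\<phi> p (Y p))"
  using contact unfolding contact_metric_3_manifold_def by simp

lemma d_eta_xi: "open N \<Longrightarrow> vector_field \<A> N X \<Longrightarrow> p \<in> N \<Longrightarrow> d_one_form \<A> \<eta> \<xi> X p = 0"
  using contact unfolding contact_metric_3_manifold_def by blast

sublocale levi_civita_frame \<A> g nab W 3 "\<lambda>i. [e, e', \<xi>] ! i"
proof
  show "smooth_atlas \<A>" "riemannian_metric \<A> g"
    using contact unfolding contact_metric_3_manifold_def by blast+
  show "levi_civita \<A> g nab" by (rule nab)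
  show "open W" by (rule W)
  show "vector_field \<A> W ([e, e', \<xi>] ! i)" if "i < 3" for i
    using that e e'_field xi_field by (auto simp: less_Suc_eq numeral_3_eq_3)
  show "orthonormal_basis \<A> g p (map (\<lambda>i. ([e, e', \<xi>] ! i) p) [0..<3])" if "p \<in> W" for p
    using basis[OF that] by (simp add: numeral_3_eq_3 e'_def)
qed

lemma frame_T:
  assumes "p \<in> W"
  shows "e p \<in> tangent_space \<A> p" "e' p \<in> tangent_space \<A> p" "\<xi> p \<in> tangent_space \<A> p"
  using assms vector_fieldD e e'_field xi_field by blast+

lemma frame_g:
  assumes "p \<in> W"
  shows "g p (e p) (e p) = 1" "g p (e p) (e' p) = 0" "g p (e p) (\<xi> p) = 0"
    "g p (e' p) (e p) = 0" "g p (e' p) (e' p) = 1" "g p (e' p) (\<xi> p) = 0"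
    "g p (\<xi> p) (e p) = 0" "g p (\<xi> p) (e' p) = 0" "g p (\<xi> p) (\<xi> p) = 1"
  using frame_orthonormal[OF assms, of 0 0] frame_orthonormal[OF assms, of 0 1] frame_orthonormal[OF assms, of 0 2]
    frame_orthonormal[OF assms, of 1 0] frame_orthonormal[OF assms, of 1 1] frame_orthonormal[OF assms, of 1 2]
    frame_orthonormal[OF assms, of 2 0] frame_orthonormal[OF assms, of 2 1] frame_orthonormal[OF assms, of 2 2]
  by simp_all

lemma frame_expand3:
  "p \<in> W \<Longrightarrow> u \<in> tangent_space \<A> p \<Longrightarrow>
    u = g p u (e p) *\<^sub>R e p + g p u (e' p) *\<^sub>R e' p + g p u (\<xi> p) *\<^sub>R \<xi> p"
  using frame_expand[of p u] unfolding sum_less_3 by simp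

lemma frame_eqI3:
  assumes "p \<in> W" "u \<in> tangent_space \<A> p" "v \<in> tangent_space \<A> p"
    and "g p u (e p) = g p v (e p)" "g p u (e' p) = g p v (e' p)" "g p u (\<xi> p) = g p v (\<xi> p)"
  shows "u = v"
  using frame_expand3[OF assms(1,2)] frame_expand3[OF assms(1,3)] assms(4-6) by metis

section \<open>The action of \<phi> on the frame and the brackets of frame fields\<close>

lemma d_eta_swap:
  assumes N: "open N" "p \<in> N" and X: "vector_field \<A> N X" and Y: "vector_field \<A> N Y"
  shows "d_one_form \<A> \<eta> X Y p = - d_one_form \<A> \<eta> Y X p"
proof -
  have "bracket \<A> Y X p \<in> tangent_space \<A> p" "bracket \<A> X Y p \<in> tangent_space \<A> p"
    using vector_fieldD[OF vector_field_bracket[OF N(1)] N(2)] X Y by auto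
  then have "\<eta> p (bracket \<A> X Y p) = - \<eta> p (bracket \<A> Y X p)"
    using bracket_swap[of X Y p] vector_fieldD[OF xi_field[of N] N(2)] by (simp add: eta_g g_uminus_left)
  then show ?thesis unfolding d_one_form_def by (simp add: field_simps)
qed

lemma phi_e: "\<phi> p (e p) = e' p"
  by (simp add: e'_def)

lemma phi_e': "p \<in> W \<Longrightarrow> \<phi> p (e' p) = - e p"
  using phi_phi[OF frame_T(1)] eta_g[OF frame_T(1)] frame_g(3) by (simp add: e'_def)

text \<open>For every \<open>X\<close>, \<open>g(X, \<phi> \<xi>)\<close> is the value of
  \<open>d \<eta>\<close> on \<open>X\<close> and \<xi>, which vanishes by antisymmetry since \<xi>
  annihilates \<open>d \<eta>\<close>.\<close>

lemma phi_xi: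
  assumes p: "p \<in> W"
  shows "\<phi> p (\<xi> p) = 0"
proof (rule frame_eqI3[OF p phi_tangent[OF frame_T(3)[OF p]] tangent_space_zero])
  have *: "g p (\<phi> p (\<xi> p)) (X p) = 0" if X: "vector_field \<A> W X" for X
  proof -
    have "g p (X p) (\<phi> p (\<xi> p)) = - d_one_form \<A> \<eta> \<xi> X p"
      using d_eta[OF W X xi_field p] d_eta_swap[OF W p X xi_field] by simp
    then show ?thesis
      using d_eta_xi[OF W X p] g_sym[OF phi_tangent[OF frame_T(3)[OF p]] vector_fieldD[OF X p]] by simp
  qed
  show "g p (\<phi> p (\<xi> p)) (e p) = g p 0 (e p)" "g p (\<phi> p (\<xi> p)) (e' p) = g p 0 (e' p)"
    "g p (\<phi> p (\<xi> p)) (\<xi> p) = g p 0 (\<xi> p)"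
    using *[OF e] *[OF e'_field] *[OF xi_field] by (simp_all add: g_zero frame_T p)
qed

lemma g_phi:
  assumes p: "p \<in> W" and u: "u \<in> tangent_space \<A> p"
  shows "g p (\<phi> p u) (e p) = - g p u (e' p)" "g p (\<phi> p u) (e' p) = g p u (e p)"
proof -
  have "\<phi> p u = \<phi> p (g p u (e p) *\<^sub>R e p + g p u (e' p) *\<^sub>R e' p + g p u (\<xi> p) *\<^sub>R \<xi> p)"
    using frame_expand3[OF p u] by simp
  also have "\<dots> = g p u (e p) *\<^sub>R e' p - g p u (e' p) *\<^sub>R e p"
    by (simp add: phi_add phi_scale phi_e phi_e' phi_xi frame_T p tangent_space_add tangent_space_scale)
  finally have *: "\<phi> p u = g p u (e p) *\<^sub>R e' p - g p u (e' p) *\<^sub>R e p" .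
  show "g p (\<phi> p u) (e p) = - g p u (e' p)" "g p (\<phi> p u) (e' p) = g p u (e p)"
    unfolding * by (simp_all add: g_diff_left g_scale_left frame_T frame_g p tangent_space_scale)
qed

text \<open>When both fields have constant \<eta>-component, the two derivative terms in
  \<open>d_one_form\<close> vanish and only \<open>- \<eta>([X,Y]) / 2\<close> is left. The factor 2
  undoes this normalization.\<close>

lemma bracket_xi:
  assumes p: "p \<in> W" and X: "vector_field \<A> W X" and Y: "vector_field \<A> W Y"
    and "\<And>q. q \<in> W \<Longrightarrow> g q (X q) (\<xi> q) = k" "\<And>q. q \<in> W \<Longrightarrow> g q (Y q) (\<xi> q) = l"
  shows "g p (bracket \<A> X Y p) (\<xi> p) = - 2 * g p (X p) (\<phi> p (Y p))"
proof -
  have "X p (\<lambda>q. \<eta> q (Y q)) = 0"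
    by (rule tangent_locally_const[OF vector_fieldD[OF X p] W p])
       (use assms(5) eta_g vector_fieldD[OF Y] in auto)
  moreover have "Y p (\<lambda>q. \<eta> q (X q)) = 0"
    by (rule tangent_locally_const[OF vector_fieldD[OF Y p] W p])
       (use assms(4) eta_g vector_fieldD[OF X] in auto)
  ultimately show ?thesis
    using d_eta[OF W X Y p] eta_g[OF vector_fieldD[OF vector_field_bracket[OF W X Y] p]]
    by (simp add: d_one_form_def)
qed

text \<open>Scaling by \<open>f\<close> produces the derivative of \<open>f\<close> along \<xi>
  times \<open>\<phi> X\<close> in both brackets, and the difference cancels it. Hence
  \<open>contact_h\<close> at \<open>e p\<close> may be computed with the field \<open>e\<close>
  itself.\<close>

lemma tensorial_h:
  assumes p: "p \<in> W"
  shows "tensorial_at p (\<lambda>X. bracket \<A> \<xi> (\<lambda>q. \<phi> q (X q)) p - \<phi> p (bracket \<A> \<xi> X p))"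
proof (rule tensorial_atI[OF W p])
  fix N X Y assume N: "open N" "p \<in> N" "N \<subseteq> W" and X: "vector_field \<A> N X" and Y: "vector_field \<A> N Y"
  note T = vector_fieldD[OF _ N(2)]
  note pX = phi_field[OF N(1) X] and pY = phi_field[OF N(1) Y]
  have "bracket \<A> \<xi> (\<lambda>q. \<phi> q (X q + Y q)) p = bracket \<A> \<xi> (\<lambda>q. \<phi> q (X q) + \<phi> q (Y q)) p"
    by (rule bracket_local[OF N(1,2) xi_field xi_field phi_field[OF N(1) vector_field_add[OF X Y]] vector_field_add[OF pX pY]])
       (simp_all add: phi_add[OF vector_fieldD[OF X] vector_fieldD[OF Y]])
  then show "bracket \<A> \<xi> (\<lambda>q. \<phi> q (X q + Y q)) p - \<phi> p (bracket \<A> \<xi> (\<lambda>q. X q + Y q) p) =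
      bracket \<A> \<xi> (\<lambda>q. \<phi> q (X q)) p - \<phi> p (bracket \<A> \<xi> X p)
      + (bracket \<A> \<xi> (\<lambda>q. \<phi> q (Y q)) p - \<phi> p (bracket \<A> \<xi> Y p))"
    using bracket_add_right[OF N(1,2) xi_field pX pY] bracket_add_right[OF N(1,2) xi_field X Y]
      phi_add[OF T[OF vector_field_bracket[OF N(1) xi_field X]] T[OF vector_field_bracket[OF N(1) xi_field Y]]]
    by simp
next
  fix N X f assume N: "open N" "p \<in> N" "N \<subseteq> W" and X: "vector_field \<A> N X" and f: "smooth_fun \<A> N f"
  note T = vector_fieldD[OF _ N(2)]
  note pX = phi_field[OF N(1) X]
  have "bracket \<A> \<xi> (\<lambda>q. \<phi> q (f q *\<^sub>R X q)) p = bracket \<A> \<xi> (\<lambda>q. f q *\<^sub>R \<phi> q (X q)) p"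
    by (rule bracket_local[OF N(1,2) xi_field xi_field phi_field[OF N(1) vector_field_scale[OF f X]] vector_field_scale[OF f pX]])
       (simp_all add: phi_scale[OF vector_fieldD[OF X]])
  then show "bracket \<A> \<xi> (\<lambda>q. \<phi> q (f q *\<^sub>R X q)) p - \<phi> p (bracket \<A> \<xi> (\<lambda>q. f q *\<^sub>R X q) p) =
      f p *\<^sub>R (bracket \<A> \<xi> (\<lambda>q. \<phi> q (X q)) p - \<phi> p (bracket \<A> \<xi> X p))"
    using bracket_scale_right[OF N(1,2) xi_field pX f] bracket_scale_right[OF N(1,2) xi_field X f]
      T[OF X] T[OF vector_field_bracket[OF N(1) xi_field X]]
    by (simp add: phi_add phi_scale tangent_space_scale algebra_simps)
qed

lemma h_bracket:
  assumes p: "p \<in> W"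
  shows "bracket \<A> \<xi> e' p - \<phi> p (bracket \<A> \<xi> e p) = (2 * ell p) *\<^sub>R e p"
proof -
  have "(1/2) *\<^sub>R (bracket \<A> \<xi> e' p - \<phi> p (bracket \<A> \<xi> e p)) = ell p *\<^sub>R e p"
    using h_e[OF p] tensorial_extend[OF p tensorial_h[OF p] W p e]
    by (simp add: contact_h_def Let_def e'_def)
  from arg_cong[OF this, of "scaleR 2"] show ?thesis by simp
qed

lemma bracket_T:
  "p \<in> W \<Longrightarrow> bracket \<A> \<xi> e p \<in> tangent_space \<A> p" "p \<in> W \<Longrightarrow> bracket \<A> \<xi> e' p \<in> tangent_space \<A> p"
  by (intro vector_fieldD[OF vector_field_bracket[OF W]] xi_field e e'_field; assumption)+

lemma bracket_e_e'_xi: "p \<in> W \<Longrightarrow> g p (bracket \<A> e e' p) (\<xi> p) = 2"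
  using bracket_xi[OF _ e e'_field frame_g(3) frame_g(6)]
  by (simp add: phi_e' g_uminus_right frame_T frame_g)

lemma bracket_xi_e_xi:
  assumes p: "p \<in> W"
  shows "g p (bracket \<A> \<xi> e p) (\<xi> p) = 0" "g p (bracket \<A> \<xi> e' p) (\<xi> p) = 0"
  using bracket_xi[OF p xi_field e frame_g(9) frame_g(3)] bracket_xi[OF p xi_field e'_field frame_g(9) frame_g(6)]
  by (simp_all add: phi_e phi_e' g_uminus_right frame_T frame_g p)

text \<open>The Jacobi identity paired with \<open>\<xi>\<close> says that the flow of \<open>\<xi>\<close> preserves \<open>d\<eta>\<close>.\<close>

lemma bracket_xi_trace:
  assumes p: "p \<in> W"
  shows "g p (bracket \<A> \<xi> e p) (e p) + g p (bracket \<A> \<xi> e' p) (e' p) = 0"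
proof -
  note B = vector_field_bracket[OF W]
  note T = vector_fieldD[OF _ p]
  note E = B[OF e e'_field] and X = B[OF xi_field e] and X' = B[OF e'_field xi_field]
  have X'0: "g q (bracket \<A> e' \<xi> q) (\<xi> q) = 0" if "q \<in> W" for q
    using bracket_xi_e_xi(2)[OF that] bracket_swap[of e' \<xi> q] that
    by (simp add: g_uminus_left bracket_T frame_T)
  \<comment> \<open>\<open>bracket_xi\<close> applies to the nested brackets because each inner one
    has constant \<xi>-component: 2 for \<open>[e,e']\<close>, and 0 for the two brackets containing
    \<xi>. This term vanishes since \<phi> kills \<xi>.\<close>
  have 1: "g p (bracket \<A> \<xi> (bracket \<A> e e') p) (\<xi> p) = 0"
    using bracket_xi[OF p E xi_field bracket_e_e'_xi frame_g(9)] bracket_swap[of \<xi> "bracket \<A> e e'" p]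
    by (simp add: g_uminus_left phi_xi g_zero T E xi_field p T[OF B[OF E xi_field]])
  have 2: "g p (bracket \<A> e (bracket \<A> e' \<xi>) p) (\<xi> p) = 2 * g p (bracket \<A> e' \<xi> p) (e' p)"
    using bracket_xi[OF p X' e X'0 frame_g(3)] bracket_swap[of e "bracket \<A> e' \<xi>" p]
    by (simp add: g_uminus_left phi_e T xi_field p T[OF B[OF X' e]])
  have 3: "g p (bracket \<A> e' (bracket \<A> \<xi> e) p) (\<xi> p) = - 2 * g p (bracket \<A> \<xi> e p) (e p)"
    using bracket_xi[OF p X e'_field bracket_xi_e_xi(1) frame_g(6)] bracket_swap[of e' "bracket \<A> \<xi> e" p]
    by (simp add: g_uminus_left g_uminus_right phi_e' T e xi_field p T[OF B[OF X e'_field]] T[OF X])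
  have "g p (bracket \<A> \<xi> (bracket \<A> e e') p + bracket \<A> e (bracket \<A> e' \<xi>) p
      + bracket \<A> e' (bracket \<A> \<xi> e) p) (\<xi> p) = 0"
    using jacobi[OF W p xi_field e e'_field] by (simp add: g_zero frame_T p)
  then have "g p (bracket \<A> e' \<xi> p) (e' p) = g p (bracket \<A> \<xi> e p) (e p)"
    using 1 2 3 by (simp add: g_add_left tangent_space_add T B X X' E xi_field e e'_field)
  then show ?thesis
    using bracket_swap[of e' \<xi> p] by (simp add: g_uminus_left bracket_T frame_T p)
qed

section \<open>Connection coefficients of the frame\<close>

definition \<Gamma> :: "'m field \<Rightarrow> 'm field \<Rightarrow> 'm field \<Rightarrow> 'm \<Rightarrow> real" where
  "\<Gamma> X Y Z p = g p (nab p (X p) Y) (Z p)"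

lemma nab_T:
  assumes p: "p \<in> W" and u: "u \<in> tangent_space \<A> p"
  shows "nab p u e \<in> tangent_space \<A> p" "nab p u e' \<in> tangent_space \<A> p" "nab p u \<xi> \<in> tangent_space \<A> p"
  using nab_tangent[OF W p] e e'_field xi_field u by auto

text \<open>Differentiate the constant function \<open>g(X,Y)\<close>.\<close>

lemma nab_skew:
  assumes p: "p \<in> W" and u: "u \<in> tangent_space \<A> p"
    and X: "vector_field \<A> W X" and Y: "vector_field \<A> W Y"
    and k: "\<And>q. q \<in> W \<Longrightarrow> g q (X q) (Y q) = k"
  shows "g p (nab p u X) (Y p) = - g p (nab p u Y) (X p)"
  using metric_compatible[OF W p X Y u] tangent_locally_const[OF u W p k]
    g_sym[OF nab_tangent[OF W p Y u] vector_fieldD[OF X p]] by simp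

lemma nab_skew_frame:
  assumes p: "p \<in> W" and u: "u \<in> tangent_space \<A> p"
  shows "g p (nab p u e) (e p) = 0" "g p (nab p u e') (e' p) = 0" "g p (nab p u \<xi>) (\<xi> p) = 0"
    and "g p (nab p u e') (e p) = - g p (nab p u e) (e' p)"
    and "g p (nab p u \<xi>) (e p) = - g p (nab p u e) (\<xi> p)"
    and "g p (nab p u \<xi>) (e' p) = - g p (nab p u e') (\<xi> p)"
  using nab_skew[OF p u e e frame_g(1)] nab_skew[OF p u e'_field e'_field frame_g(5)]
    nab_skew[OF p u xi_field xi_field frame_g(9)] nab_skew[OF p u e'_field e frame_g(4)]
    nab_skew[OF p u xi_field e frame_g(7)] nab_skew[OF p u xi_field e'_field frame_g(8)]
  by simp_all

text \<open>Restricted to the plane of \<open>e\<close> and \<open>e'\<close>, the derivative of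
  \<xi> is a 2 by 2 matrix. Its antisymmetric part comes from \<open>[e,e']\<close>, its trace from
  \<open>bracket_xi_trace\<close>, and its symmetric trace-free part from the two plane components
  of \<open>h e\<close>.\<close>

lemma connection_coefficients:
  assumes p: "p \<in> W"
  shows "g p (nab p (\<xi> p) e) (\<xi> p) = 0" "g p (nab p (\<xi> p) e') (\<xi> p) = 0"
    "g p (nab p (e p) e) (\<xi> p) = 0" "g p (nab p (e p) e') (\<xi> p) = 1 + ell p"
    "g p (nab p (e' p) e) (\<xi> p) = ell p - 1" "g p (nab p (e' p) e') (\<xi> p) = 0"
proof -
  note T = frame_T[OF p]
  note nT = nab_T[OF p T(1)] nab_T[OF p T(2)] nab_T[OF p T(3)]
  note skew = nab_skew_frame[OF p T(1)] nab_skew_frame[OF p T(2)] nab_skew_frame[OF p T(3)]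
  note br = torsion_free[OF W p xi_field e] torsion_free[OF W p xi_field e'_field] torsion_free[OF W p e e'_field]
  \<comment> \<open>By \<open>g_phi\<close>, the \<open>e\<close>-component of this identity fixes
    the symmetric off-diagonal entry, and the \<open>e'\<close>-component says that the diagonal
    entries agree. As they sum to zero, both vanish.\<close>
  have h: "g p (bracket \<A> \<xi> e' p - \<phi> p (bracket \<A> \<xi> e p)) (e p) = 2 * ell p"
    "g p (bracket \<A> \<xi> e' p - \<phi> p (bracket \<A> \<xi> e p)) (e' p) = 0"
    unfolding h_bracket[OF p] by (simp_all add: g_scale_left T frame_g p)
  have h1: "g p (bracket \<A> \<xi> e' p) (e p) + g p (bracket \<A> \<xi> e p) (e' p) = 2 * ell p"
    and h2: "g p (bracket \<A> \<xi> e' p) (e' p) = g p (bracket \<A> \<xi> e p) (e p)"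
    using h by (simp_all add: g_diff_left T bracket_T p phi_tangent g_phi)
  show "g p (nab p (\<xi> p) e) (\<xi> p) = 0" "g p (nab p (\<xi> p) e') (\<xi> p) = 0"
    using bracket_xi_e_xi[OF p] unfolding br by (simp_all add: g_diff_left T nT skew)
  show "g p (nab p (e p) e) (\<xi> p) = 0" "g p (nab p (e' p) e') (\<xi> p) = 0"
    using bracket_xi_trace[OF p] h2 unfolding br by (simp_all add: g_diff_left T nT skew)
  have "g p (nab p (e p) e') (\<xi> p) - g p (nab p (e' p) e) (\<xi> p) = 2"
    using bracket_e_e'_xi[OF p] unfolding br by (simp add: g_diff_left T nT)
  moreover have "g p (nab p (e p) e') (\<xi> p) + g p (nab p (e' p) e) (\<xi> p) = 2 * ell p"
    using h1 unfolding br by (simp add: g_diff_left T nT skew)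
  ultimately show "g p (nab p (e p) e') (\<xi> p) = 1 + ell p" "g p (nab p (e' p) e) (\<xi> p) = ell p - 1"
    by simp_all
qed

lemma nab_xi:
  assumes p: "p \<in> W"
  shows "nab p (\<xi> p) \<xi> = 0" "nab p (e p) \<xi> = (- 1 - ell p) *\<^sub>R e' p" "nab p (e' p) \<xi> = (1 - ell p) *\<^sub>R e p"
    "nab p (\<xi> p) e = \<Gamma> \<xi> e e' p *\<^sub>R e' p" "nab p (\<xi> p) e' = - \<Gamma> \<xi> e e' p *\<^sub>R e p"
proof -
  note T = frame_T[OF p]
  note nT = nab_T[OF p T(1)] nab_T[OF p T(2)] nab_T[OF p T(3)]
  note skew = nab_skew_frame[OF p T(1)] nab_skew_frame[OF p T(2)] nab_skew_frame[OF p T(3)]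
  note simps = skew connection_coefficients[OF p] frame_g[OF p] T nT tangent_space_zero tangent_space_scale
    g_zero g_scale_left g_uminus_left tangent_space_uminus
  show "nab p (\<xi> p) \<xi> = 0" "nab p (e p) \<xi> = (- 1 - ell p) *\<^sub>R e' p" "nab p (e' p) \<xi> = (1 - ell p) *\<^sub>R e p"
    "nab p (\<xi> p) e = \<Gamma> \<xi> e e' p *\<^sub>R e' p" "nab p (\<xi> p) e' = - \<Gamma> \<xi> e e' p *\<^sub>R e p"
    unfolding \<Gamma>_def by (rule frame_eqI3[OF p]; simp add: simps)+
qed

section \<open>Curvature and Ricci components in the frame\<close>

lemma nab_zero_field:
  assumes p: "p \<in> W" and u: "u \<in> tangent_space \<A> p"
  shows "nab p u (\<lambda>q. 0) = 0"
  using nab_leibniz[OF W p xi_field smooth_fun_const[of W 0] u] tangent_const[OF u] by simp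

text \<open>The brackets of \<xi> with \<open>e\<close> and \<open>e'\<close> are multiples of
  \<open>e'\<close> and \<open>e\<close>, and all covariant derivatives that occur are those of
  \<open>nab_xi\<close>. The computation therefore closes up in \<open>a\<close>, \<open>ell\<close>
  and the derivative of \<open>ell\<close> along \<xi>.\<close>

lemma curvature_xi:
  assumes p: "p \<in> W"
  defines "a \<equiv> \<Gamma> \<xi> e e' p"
  shows "curvature \<A> nab \<xi> e \<xi> p = (a * (1 + ell p) - (a + 1 + ell p) * (1 - ell p)) *\<^sub>R e p - \<xi> p ell *\<^sub>R e' p"
    and "curvature \<A> nab \<xi> e' \<xi> p = (a * (1 - ell p) - (a + 1 - ell p) * (1 + ell p)) *\<^sub>R e' p - \<xi> p ell *\<^sub>R e p"
proof -
  note T = frame_T[OF p]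
  note ell' = smooth_nearI[OF W p ell]
  have s1: "smooth_fun \<A> W (\<lambda>q. - 1 - ell q)" and s2: "smooth_fun \<A> W (\<lambda>q. 1 - ell q)"
    by (intro smooth_fun_diff smooth_fun_const W ell)+
  have d1: "\<xi> p (\<lambda>q. - 1 - ell q) = - \<xi> p ell" and d2: "\<xi> p (\<lambda>q. 1 - ell q) = - \<xi> p ell"
    using tangent_diff[OF T(3) smooth_near_const ell'] tangent_const[OF T(3)] by simp_all
  have n0: "nab p u (\<lambda>q. nab q (\<xi> q) \<xi>) = 0" if u: "u \<in> tangent_space \<A> p" for u
    using nab_local[OF W p vector_field_nab[OF W xi_field xi_field] nab_xi(1) u] nab_zero_field[OF p u] by simp
  \<comment> \<open>The inner derivative is \<open>(- 1 - ell) *\<^sub>R e'\<close> on all of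
    \<open>W\<close>, so it may be differentiated again by the Leibniz rule.\<close>
  have n1: "nab p (\<xi> p) (\<lambda>q. nab q (e q) \<xi>) = - \<xi> p ell *\<^sub>R e' p + (- 1 - ell p) *\<^sub>R nab p (\<xi> p) e'"
    using nab_local[OF W p vector_field_nab[OF W e xi_field] nab_xi(2) T(3)]
      nab_leibniz[OF W p e'_field s1 T(3)] d1 by simp
  have n2: "nab p (\<xi> p) (\<lambda>q. nab q (e' q) \<xi>) = - \<xi> p ell *\<^sub>R e p + (1 - ell p) *\<^sub>R nab p (\<xi> p) e"
    using nab_local[OF W p vector_field_nab[OF W e'_field xi_field] nab_xi(3) T(3)]
      nab_leibniz[OF W p e s2 T(3)] d2 by simp
  have b1: "bracket \<A> \<xi> e p = (a + 1 + ell p) *\<^sub>R e' p" and b2: "bracket \<A> \<xi> e' p = (- a - 1 + ell p) *\<^sub>R e p"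
    unfolding torsion_free[OF W p xi_field e] torsion_free[OF W p xi_field e'_field] nab_xi[OF p] a_def
    by (simp_all add: algebra_simps)
  show "curvature \<A> nab \<xi> e \<xi> p = (a * (1 + ell p) - (a + 1 + ell p) * (1 - ell p)) *\<^sub>R e p - \<xi> p ell *\<^sub>R e' p"
  proof -
    have c: "a * (1 + ell p) - (a + 1 + ell p) * (1 - ell p) = (- 1 - ell p) * (- a) - (a + 1 + ell p) * (1 - ell p)"
      by (simp add: algebra_simps)
    show ?thesis
      unfolding curvature_def n0[OF T(1)] n1 b1 nab_scale_dir[OF W p xi_field T(2)] nab_xi[OF p] c
        scaleR_left_diff_distrib[of "(- 1 - ell p) * (- a)"] a_def[symmetric]
      by simp
  qed
  show "curvature \<A> nab \<xi> e' \<xi> p = (a * (1 - ell p) - (a + 1 - ell p) * (1 + ell p)) *\<^sub>R e' p - \<xi> p ell *\<^sub>R e p"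
  proof -
    have c: "a * (1 - ell p) - (a + 1 - ell p) * (1 + ell p) = (1 - ell p) * a - (- a - 1 + ell p) * (- 1 - ell p)"
      by (simp add: algebra_simps)
    show ?thesis
      unfolding curvature_def n0[OF T(2)] n2 b2 nab_scale_dir[OF W p xi_field T(1)] nab_xi[OF p] c
        scaleR_left_diff_distrib[of "(1 - ell p) * a"] a_def[symmetric]
      by simp
  qed
qed

text \<open>The (0,4) curvature tensor. With this argument order, \<open>Rm p X Y Y X\<close> is the
  sectional curvature of an orthonormal pair.\<close>

definition Rm :: "'m \<Rightarrow> 'm field \<Rightarrow> 'm field \<Rightarrow> 'm field \<Rightarrow> 'm field \<Rightarrow> real" where
  "Rm p X Y Z U = g p (curvature \<A> nab X Y Z p) (U p)"

lemma Rm_swap: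
  assumes "p \<in> W" "vector_field \<A> W X" "vector_field \<A> W Y" "vector_field \<A> W Z" "vector_field \<A> W U"
  shows "Rm p X Y Z U = - Rm p Y X Z U"
  unfolding Rm_def curvature_swap[OF W assms(1,2,3,4)]
  using g_uminus_left[OF curvature_tangent[OF W assms(1,3,2,4)] vector_fieldD[OF assms(5,1)]] .

lemma Rm_skew:
  assumes "p \<in> W" "vector_field \<A> W X" "vector_field \<A> W Y" "vector_field \<A> W Z" "vector_field \<A> W U"
  shows "Rm p X Y Z U = - Rm p X Y U Z"
  unfolding Rm_def curvature_skew[OF W assms]
  using g_sym[OF curvature_tangent[OF W assms(1,2,3,5)] vector_fieldD[OF assms(4,1)]] by simp

lemma Rm_bianchi:
  assumes "p \<in> W" "vector_field \<A> W X" "vector_field \<A> W Y" "vector_field \<A> W Z" "vector_field \<A> W U"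
  shows "Rm p X Y Z U + Rm p Y Z X U + Rm p Z X Y U = 0"
proof -
  note T = curvature_tangent[OF W assms(1)]
  have "g p (curvature \<A> nab X Y Z p + curvature \<A> nab Y Z X p + curvature \<A> nab Z X Y p) (U p) = 0"
    unfolding bianchi[OF W assms(1-4)] by (rule g_zero[OF vector_fieldD[OF assms(5,1)]])
  then show ?thesis
    unfolding Rm_def
    by (simp add: g_add_left tangent_space_add T assms vector_fieldD[OF assms(5,1)])
qed

lemma Ric_Rm:
  assumes p: "p \<in> W" and X: "vector_field \<A> W X" and Y: "vector_field \<A> W Y"
  shows "Ric \<A> g nab p (X p) (Y p) = Rm p e X Y e + Rm p e' X Y e' + Rm p \<xi> X Y \<xi>"
  using Ric_frame[OF p W p X Y] unfolding sum_less_3 Rm_def by simp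

text \<open>Write K for sectional curvature. Then \<open>R(e,e) = K(e,e') + K(\<xi>,e)\<close>, and
  \<open>r\<close> is twice the sum of the three sectional curvatures, so
  \<open>R(e,e) = r/2 - K(\<xi>,e')\<close>; likewise for \<open>e'\<close>. By
  \<open>curvature_xi\<close>, \<open>K(\<xi>,e) = 1 - ell^2 - 2 a ell\<close> and
  \<open>K(\<xi>,e') = 1 - ell^2 + 2 a ell\<close>.\<close>

lemma Ric_components:
  assumes p: "p \<in> W"
  defines "R \<equiv> Ric \<A> g nab p" and "a \<equiv> \<Gamma> \<xi> e e' p" and "r \<equiv> scalar_curvature \<A> g nab p"
  shows "R (e p) (e p) = r / 2 - 1 + (ell p)\<^sup>2 - 2 * a * ell p"
    and "R (e' p) (e' p) = r / 2 - 1 + (ell p)\<^sup>2 + 2 * a * ell p"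
    and "R (\<xi> p) (\<xi> p) = 2 * (1 - (ell p)\<^sup>2)"
    and "R (e p) (e' p) = \<xi> p ell" "R (e' p) (e p) = \<xi> p ell"
    and "R (\<xi> p) (e p) = R (e p) (\<xi> p)" "R (\<xi> p) (e' p) = R (e' p) (\<xi> p)"
proof -
  note T = frame_T[OF p] and F = e e'_field xi_field
  have K: "Rm p \<xi> e \<xi> e = a * (1 + ell p) - (a + 1 + ell p) * (1 - ell p)" "Rm p \<xi> e \<xi> e' = - \<xi> p ell"
    "Rm p \<xi> e' \<xi> e' = a * (1 - ell p) - (a + 1 - ell p) * (1 + ell p)" "Rm p \<xi> e' \<xi> e = - \<xi> p ell"
    unfolding Rm_def curvature_xi[OF p] a_def
    by (simp_all add: g_diff_left g_scale_left T frame_g p tangent_space_scale)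
  have zero: "Rm p X X Y Z = 0" "Rm p X Y Z Z = 0"
    if "vector_field \<A> W X" "vector_field \<A> W Y" "vector_field \<A> W Z" for X Y Z
    using Rm_swap[OF p that(1,1,2,3)] Rm_skew[OF p that(1,2,3,3)] by simp_all
  note simps = R_def Ric_Rm p F zero
  have sec: "Rm p e e' e' e = Rm p e' e e e'"
    using Rm_swap[OF p F(1,2,2,1)] Rm_skew[OF p F(2,1,2,1)] by simp
  have xi: "Rm p \<xi> e e \<xi> = - Rm p \<xi> e \<xi> e" "Rm p \<xi> e e' \<xi> = - Rm p \<xi> e \<xi> e'"
    "Rm p \<xi> e' e \<xi> = - Rm p \<xi> e' \<xi> e" "Rm p \<xi> e' e' \<xi> = - Rm p \<xi> e' \<xi> e'"
    "Rm p e \<xi> \<xi> e = - Rm p \<xi> e \<xi> e" "Rm p e' \<xi> \<xi> e' = - Rm p \<xi> e' \<xi> e'"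
    using Rm_skew[OF p F(3,1,1,3)] Rm_skew[OF p F(3,1,2,3)] Rm_skew[OF p F(3,2,1,3)] Rm_skew[OF p F(3,2,2,3)]
      Rm_swap[OF p F(1,3,3,1)] Rm_swap[OF p F(2,3,3,2)] by simp_all
  have ee: "R (e p) (e p) = Rm p e' e e e' - Rm p \<xi> e \<xi> e"
    and e'e': "R (e' p) (e' p) = Rm p e' e e e' - Rm p \<xi> e' \<xi> e'"
    and xx: "R (\<xi> p) (\<xi> p) = - Rm p \<xi> e \<xi> e - Rm p \<xi> e' \<xi> e'"
    by (simp_all add: simps sec xi)
  have r: "r = R (e p) (e p) + R (e' p) (e' p) + R (\<xi> p) (\<xi> p)"
    using scalar_curvature_frame[OF p] unfolding sum_less_3 r_def R_def by simp
  show "R (\<xi> p) (\<xi> p) = 2 * (1 - (ell p)\<^sup>2)"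
    unfolding xx K by (simp add: algebra_simps power2_eq_square)
  show "R (e p) (e p) = r / 2 - 1 + (ell p)\<^sup>2 - 2 * a * ell p"
    "R (e' p) (e' p) = r / 2 - 1 + (ell p)\<^sup>2 + 2 * a * ell p"
    unfolding r ee e'e' xx K by (simp_all add: field_simps power2_eq_square)
  show "R (e p) (e' p) = \<xi> p ell" "R (e' p) (e p) = \<xi> p ell"
    by (simp_all add: simps xi K)
  \<comment> \<open>Each side has a single surviving curvature term, and the Bianchi identity
    identifies the two because its third term has a repeated last pair.\<close>
  show "R (\<xi> p) (e p) = R (e p) (\<xi> p)"
    using Rm_bianchi[OF p F(2,1,3,2)] Rm_swap[OF p F(2,3,1,2)] by (simp add: simps)
  show "R (\<xi> p) (e' p) = R (e' p) (\<xi> p)"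
    using Rm_bianchi[OF p F(1,2,3,1)] Rm_swap[OF p F(1,3,2,1)] by (simp add: simps)
qed

section \<open>The soliton equation in components\<close>

lemma nab_combination:
  assumes p: "p \<in> W" and u: "u \<in> tangent_space \<A> p"
    and V: "vector_field \<A> W V" "\<And>q. q \<in> W \<Longrightarrow> V q = f1 q *\<^sub>R e q + f2 q *\<^sub>R e' q + f3 q *\<^sub>R \<xi> q"
  shows "nab p u V = u f1 *\<^sub>R e p + f1 p *\<^sub>R nab p u e + (u f2 *\<^sub>R e' p + f2 p *\<^sub>R nab p u e')
    + (u f3 *\<^sub>R \<xi> p + f3 p *\<^sub>R nab p u \<xi>)"
proof -
  \<comment> \<open>The coefficients are recovered as metric products of \<open>V\<close> with the
    frame, which makes them smooth on \<open>W\<close> and licenses the Leibniz rule.\<close>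
  have f: "g q (V q) (e q) = f1 q" "g q (V q) (e' q) = f2 q" "g q (V q) (\<xi> q) = f3 q" if q: "q \<in> W" for q
    unfolding V(2)[OF q]
    by (simp_all add: g_add_left g_scale_left frame_T frame_g q tangent_space_add tangent_space_scale)
  have f1: "smooth_fun \<A> W f1" and f2: "smooth_fun \<A> W f2" and f3: "smooth_fun \<A> W f3"
    using smooth_fun_cong[OF W f(1) smooth_fun_g[OF W V(1) e]]
      smooth_fun_cong[OF W f(2) smooth_fun_g[OF W V(1) e'_field]]
      smooth_fun_cong[OF W f(3) smooth_fun_g[OF W V(1) xi_field]] by simp_all
  note s = vector_field_scale[OF f1 e] vector_field_scale[OF f2 e'_field] vector_field_scale[OF f3 xi_field[of W]]
  have "nab p u V = nab p u (\<lambda>q. f1 q *\<^sub>R e q + f2 q *\<^sub>R e' q + f3 q *\<^sub>R \<xi> q)"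
    by (rule nab_local[OF W p V u])
  also have "\<dots> = nab p u (\<lambda>q. f1 q *\<^sub>R e q) + nab p u (\<lambda>q. f2 q *\<^sub>R e' q) + nab p u (\<lambda>q. f3 q *\<^sub>R \<xi> q)"
    unfolding nab_add[OF W p vector_field_add[OF s(1,2)] s(3) u] nab_add[OF W p s(1,2) u] ..
  finally show ?thesis
    unfolding nab_leibniz[OF W p e f1 u] nab_leibniz[OF W p e'_field f2 u] nab_leibniz[OF W p xi_field f3 u] .
qed

lemma soliton_iff:
  assumes V: "vector_field \<A> W V" "\<And>q. q \<in> W \<Longrightarrow> V q = f1 q *\<^sub>R e q + f2 q *\<^sub>R e' q + f3 q *\<^sub>R \<xi> q"
  shows "almost_rb_soliton_on \<A> g nab W V lam rho \<longleftrightarrow>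
    (\<forall>p\<in>W. let r = scalar_curvature \<A> g nab p; L = lam p + rho * r; a = \<Gamma> \<xi> e e' p;
         b = \<Gamma> e e e' p; c = \<Gamma> e' e' e p in
       r / 2 - 1 + (ell p)\<^sup>2 - 2 * a * ell p + e p f1 - b * f2 p = L \<and>
       r / 2 - 1 + (ell p)\<^sup>2 + 2 * a * ell p + e' p f2 - c * f1 p = L \<and>
       2 * (1 - (ell p)\<^sup>2) + \<xi> p f3 = L \<and>
       \<xi> p ell + (1/2) * (e p f2 + e' p f1 + b * f1 p + c * f2 p - 2 * ell p * f3 p) = 0 \<and>
       Ric \<A> g nab p (e p) (\<xi> p) + (1/2) * (e p f3 + \<xi> p f1 + (1 + ell p - a) * f2 p) = 0 \<and>
       Ric \<A> g nab p (e' p) (\<xi> p) + (1/2) * (e' p f3 + \<xi> p f2 + (a + ell p - 1) * f1 p) = 0)"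
  unfolding soliton_on_frame[OF V(1)]
proof (rule ball_cong[OF refl])
  fix p assume p: "p \<in> W"
  note T = frame_T[OF p]
  note nT = nab_T[OF p T(1)] nab_T[OF p T(2)] nab_T[OF p T(3)]
  note skew = nab_skew_frame[OF p T(1)] nab_skew_frame[OF p T(2)] nab_skew_frame[OF p T(3)]
  have nV: "nab p u V = u f1 *\<^sub>R e p + f1 p *\<^sub>R nab p u e + (u f2 *\<^sub>R e' p + f2 p *\<^sub>R nab p u e')
    + (u f3 *\<^sub>R \<xi> p + f3 p *\<^sub>R nab p u \<xi>)" if "u \<in> tangent_space \<A> p" for u
    by (rule nab_combination[OF p that V])
  \<comment> \<open>The sign in the last equation appears because \<open>c\<close> is
    \<open>\<Gamma> e' e' e\<close>, whereas expanding \<open>V\<close> produces the derivative of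
    \<open>e\<close>, not \<open>e'\<close>, along \<open>e'\<close>.\<close>
  have G: "g p (nab p (\<xi> p) e) (e' p) = \<Gamma> \<xi> e e' p" "g p (nab p (e p) e) (e' p) = \<Gamma> e e e' p"
    "g p (nab p (e' p) e) (e' p) = - \<Gamma> e' e' e p"
    unfolding \<Gamma>_def by (simp_all add: skew)
  have nVT: "nab p u V \<in> tangent_space \<A> p" if "u \<in> tangent_space \<A> p" for u
    by (rule nab_tangent[OF W p V(1) that])
  have sym: "g p u (nab p v V) = g p (nab p v V) u"
    if "u \<in> tangent_space \<A> p" "v \<in> tangent_space \<A> p" for u v
    by (rule g_sym[OF that(1) nVT[OF that(2)]])
  note simps = g_add_left g_scale_left T nT tangent_space_add tangent_space_scale frame_g[OF p] skew
    connection_coefficients[OF p] G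
  \<comment> \<open>The nine components of the derivative of \<open>V\<close>. Symmetrizing them
    combines, for instance, \<open>- (1 + ell) * f3\<close> and \<open>(1 - ell) * f3\<close> into
    the term \<open>- 2 * ell * f3\<close> of the fourth equation.\<close>
  have D:
    "g p (nab p (e p) V) (e p) = e p f1 - \<Gamma> e e e' p * f2 p"
    "g p (nab p (e p) V) (e' p) = e p f2 + \<Gamma> e e e' p * f1 p - (1 + ell p) * f3 p"
    "g p (nab p (e p) V) (\<xi> p) = e p f3 + (1 + ell p) * f2 p"
    "g p (nab p (e' p) V) (e p) = e' p f1 + \<Gamma> e' e' e p * f2 p + (1 - ell p) * f3 p"
    "g p (nab p (e' p) V) (e' p) = e' p f2 - \<Gamma> e' e' e p * f1 p"
    "g p (nab p (e' p) V) (\<xi> p) = e' p f3 + (ell p - 1) * f1 p"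
    "g p (nab p (\<xi> p) V) (e p) = \<xi> p f1 - \<Gamma> \<xi> e e' p * f2 p"
    "g p (nab p (\<xi> p) V) (e' p) = \<xi> p f2 + \<Gamma> \<xi> e e' p * f1 p"
    "g p (nab p (\<xi> p) V) (\<xi> p) = \<xi> p f3"
    by (simp_all add: nV simps algebra_simps)
  show "(\<forall>i<3. \<forall>j<3. Ric \<A> g nab p (([e, e', \<xi>] ! i) p) (([e, e', \<xi>] ! j) p)
        + (1/2) * (g p (nab p (([e, e', \<xi>] ! i) p) V) (([e, e', \<xi>] ! j) p)
          + g p (([e, e', \<xi>] ! i) p) (nab p (([e, e', \<xi>] ! j) p) V))
      = (if i = j then lam p + rho * scalar_curvature \<A> g nab p else 0)) \<longleftrightarrow>
    (let r = scalar_curvature \<A> g nab p; L = lam p + rho * r; a = \<Gamma> \<xi> e e' p;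
         b = \<Gamma> e e e' p; c = \<Gamma> e' e' e p in
       r / 2 - 1 + (ell p)\<^sup>2 - 2 * a * ell p + e p f1 - b * f2 p = L \<and>
       r / 2 - 1 + (ell p)\<^sup>2 + 2 * a * ell p + e' p f2 - c * f1 p = L \<and>
       2 * (1 - (ell p)\<^sup>2) + \<xi> p f3 = L \<and>
       \<xi> p ell + (1/2) * (e p f2 + e' p f1 + b * f1 p + c * f2 p - 2 * ell p * f3 p) = 0 \<and>
       Ric \<A> g nab p (e p) (\<xi> p) + (1/2) * (e p f3 + \<xi> p f1 + (1 + ell p - a) * f2 p) = 0 \<and>
       Ric \<A> g nab p (e' p) (\<xi> p) + (1/2) * (e' p f3 + \<xi> p f2 + (a + ell p - 1) * f1 p) = 0)"
    unfolding all_less_3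
    \<comment> \<open>The nine index pairs give each off-diagonal equation twice; \<open>sym\<close>
      and the symmetry of the Ricci components merge the copies, leaving six equations.\<close>
    by (simp add: Let_def sym T D Ric_components[OF p]) (auto simp: field_simps)
qed

end

theorem proposition3p1:
  fixes \<A> :: "('m::{t2_space, second_countable_topology}, real^3) atlas"
    and \<phi> :: "'m endo" and \<xi> :: "'m field" and \<eta> :: "'m one_form" and g :: "'m metric"
    and nab :: "'m connection"
    and lam r Lam ell a b c A B Z f1 f2 f3 :: "'m \<Rightarrow> real" and rho :: real
    and W :: "'m set" and e V :: "'m field"
  assumes contact: "contact_metric_3_manifold \<A> \<phi> \<xi> \<eta> g"
    and nab: "levi_civita \<A> g nab"
    and r: "\<And>p. r p = scalar_curvature \<A> g nab p"
    and lam: "smooth_fun \<A> UNIV lam"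
    and W: "open W" "W \<subseteq> h_support \<A> \<phi> \<xi>"
    and e: "vector_field \<A> W e"
    and basis: "\<And>p. p \<in> W \<Longrightarrow> orthonormal_basis \<A> g p [e p, \<phi> p (e p), \<xi> p]"
    and ell: "smooth_fun \<A> W ell" "\<And>p. p \<in> W \<Longrightarrow> ell p > 0"
    and h_e: "\<And>p. p \<in> W \<Longrightarrow> contact_h \<A> \<phi> \<xi> p (e p) = ell p *\<^sub>R e p"
    and h_phi_e: "\<And>p. p \<in> W \<Longrightarrow> contact_h \<A> \<phi> \<xi> p (\<phi> p (e p)) = - ell p *\<^sub>R \<phi> p (e p)"
    and a: "\<And>p. p \<in> W \<Longrightarrow> a p = g p (nab p (\<xi> p) e) (\<phi> p (e p))"
    and b: "\<And>p. p \<in> W \<Longrightarrow> b p = g p (nab p (e p) e) (\<phi> p (e p))"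
    and c: "\<And>p. p \<in> W \<Longrightarrow> c p = g p (nab p (\<phi> p (e p)) (\<lambda>q. \<phi> q (e q))) (e p)"
    and A: "\<And>p. p \<in> W \<Longrightarrow> A p = Ric \<A> g nab p (e p) (\<xi> p)"
    and B: "\<And>p. p \<in> W \<Longrightarrow> B p = Ric \<A> g nab p (\<phi> p (e p)) (\<xi> p)"
    and Z: "\<And>p. p \<in> W \<Longrightarrow> Z p = \<xi> p ell"
    and V: "vector_field \<A> W V"
      "\<And>p. p \<in> W \<Longrightarrow> V p = f1 p *\<^sub>R e p + f2 p *\<^sub>R \<phi> p (e p) + f3 p *\<^sub>R \<xi> p"
    and Lam: "\<And>p. Lam p = lam p + rho * r p"
  shows "almost_rb_soliton_on \<A> g nab W V lam rho \<longleftrightarrow>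
    (\<forall>p\<in>W.
       r p / 2 - 1 + (ell p)\<^sup>2 - 2 * a p * ell p + e p f1 - b p * f2 p = Lam p \<and>
       r p / 2 - 1 + (ell p)\<^sup>2 + 2 * a p * ell p + \<phi> p (e p) f2 - c p * f1 p = Lam p \<and>
       2 * (1 - (ell p)\<^sup>2) + \<xi> p f3 = Lam p \<and>
       Z p + (1/2) * (e p f2 + \<phi> p (e p) f1 + b p * f1 p + c p * f2 p - 2 * ell p * f3 p) = 0 \<and>
       A p + (1/2) * (e p f3 + \<xi> p f1 + (1 + ell p - a p) * f2 p) = 0 \<and>
       B p + (1/2) * (\<phi> p (e p) f3 + \<xi> p f2 + (a p + ell p - 1) * f1 p) = 0)"
proof -
  interpret contact_frame \<A> \<phi> \<xi> \<eta> g nab W e ell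
    by unfold_locales (use contact nab W(1) e basis ell(1) h_e in auto)
  have coeffs: "\<Gamma> \<xi> e e' p = a p" "\<Gamma> e e e' p = b p" "\<Gamma> e' e' e p = c p" if "p \<in> W" for p
    using a[OF that] b[OF that] c[OF that] by (simp_all add: \<Gamma>_def e'_def)
  show ?thesis
  proof (rule trans[OF soliton_iff[OF V(1), of f1 f2 f3]])
    show "V q = f1 q *\<^sub>R e q + f2 q *\<^sub>R e' q + f3 q *\<^sub>R \<xi> q" if "q \<in> W" for q
      using V(2)[OF that] by (simp add: e'_def)
  qed (rule ball_cong[OF refl], simp only: Let_def coeffs A B Z Lam r phi_e)
qed

end
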